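(* Consider the data model $y_i=\theta_{0,i}+\epsilon_i$, $i=1,\ldots,n$, where $\epsilon_1,\ldots,\epsilon_n$ are i.i.d. sub-Gaussian errors, i.e., $\mathbb{E}(\epsilon_i)=0$ and $\mathbb{P}(|\epsilon_i|>u)\le M\exp(-u^2/(2\sigma^2))$ for all $u\ge 0$, for constants $M,\sigma>0$, and where $\theta_0\in\mathrm{BV}_G(t)$ for a generic connected undirected graph $G$ on $V=\{1,\ldots,n\}$. Then the fused lasso estimator over $G$, $$\hat\theta_G=\operatorname*{argmin}_{\theta\in\mathbb{R}^n}\ \tfrac12\|y-\theta\|_2^2+\lambda\|\nabla_G\theta\|_1,$$ under a choice of tuning parameter $\lambda\asymp t^{-1/3}n^{1/3}$, has mean squared error converging in probability at the rate $$\|\hat\theta_G-\theta_0\|_n^2=O_{\mathbb{P}}(t^{2/3}n^{-2/3}).$$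
   Context: For a graph $G=(V,E)$ with each edge $e$ arbitrarily oriented with endpoints $e^+,e^-$, the edge incidence matrix $\nabla_G$ satisfies $(\nabla_G\theta)_e=\theta_{e^+}-\theta_{e^-}$, so $\|\nabla_G\theta\|_1=\sum_{e\in E}|\theta_{e^+}-\theta_{e^-}|$, and for a radius $t>0$, $\mathrm{BV}_G(t)=\{\theta\in\mathbb{R}^n:\|\nabla_G\theta\|_1\le t\}$. $\|x\|_n^2=\|x\|_2^2/n$. $a_n=O(b_n)$ means $a_n/b_n$ is upper bounded for $n$ large enough; $a_n\asymp b_n$ means both $a_n=O(b_n)$ and $a_n^{-1}=O(b_n^{-1})$; $A_n=O_{\mathbb{P}}(B_n)$ means that $A_n/B_n$ is bounded in probability.
   Formalization: The radius t may vary with n but 1/t = O(n^{1/2}) is assumed (automatic for fixed t > 0); without it the rate fails, e.g. for Gaussian errors and t = 1/n, since the mean squared error is at least the squared average error, of order 1/n. *)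

theory Defs
  imports "HOL-Probability.Probability" "HOL-Library.Landau_Symbols"
begin

(* R^n with coordinates 1..n, for n varying inside a statement.  Vectors are extensional functions,
   so equality of vectors is equality of the n coordinates. *)
definition Rn :: "nat \<Rightarrow> (nat \<Rightarrow> real) set" where
  "Rn n = {1..n} \<rightarrow>\<^sub>E UNIV"

(* Finite simple undirected graph with vertex set V and edge set E, an edge being a two-element
   set of vertices; connected means that any two vertices are joined by a walk. *)
definition connected_graph :: "'v set \<Rightarrow> 'v set set \<Rightarrow> bool" where
  "connected_graph V E \<longleftrightarrow>
     finite V \<and> V \<noteq> {} \<and> (\<forall>e\<in>E. e \<subseteq> V \<and> card e = 2) \<and>
     (\<forall>u\<in>V. \<forall>v\<in>V. (u, v) \<in> {(x, y). {x, y} \<in> E}\<^sup>*)"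

definition edge_orientation :: "'v set set \<Rightarrow> ('v set \<Rightarrow> 'v) \<Rightarrow> ('v set \<Rightarrow> 'v) \<Rightarrow> bool" where
  "edge_orientation E ep em \<longleftrightarrow> (\<forall>e\<in>E. e = {ep e, em e})"

(* Action of the edge incidence matrix for the orientation (ep, em). *)
definition nabla :: "('v set \<Rightarrow> 'v) \<Rightarrow> ('v set \<Rightarrow> 'v) \<Rightarrow> ('v \<Rightarrow> real) \<Rightarrow> 'v set \<Rightarrow> real" where
  "nabla ep em \<theta> e = \<theta> (ep e) - \<theta> (em e)"

definition nabla_norm1 ::
  "'v set set \<Rightarrow> ('v set \<Rightarrow> 'v) \<Rightarrow> ('v set \<Rightarrow> 'v) \<Rightarrow> ('v \<Rightarrow> real) \<Rightarrow> real" where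
  "nabla_norm1 E ep em \<theta> = (\<Sum>e\<in>E. \<bar>nabla ep em \<theta> e\<bar>)"

definition BV ::
  "nat \<Rightarrow> nat set set \<Rightarrow> (nat set \<Rightarrow> nat) \<Rightarrow> (nat set \<Rightarrow> nat) \<Rightarrow> real \<Rightarrow> (nat \<Rightarrow> real) set" where
  "BV n E ep em t = {\<theta> \<in> Rn n. nabla_norm1 E ep em \<theta> \<le> t}"

definition sq_norm2 :: "nat \<Rightarrow> (nat \<Rightarrow> real) \<Rightarrow> real" where
  "sq_norm2 n x = (\<Sum>i=1..n. (x i)\<^sup>2)"

definition sq_norm_n :: "nat \<Rightarrow> (nat \<Rightarrow> real) \<Rightarrow> real" where
  "sq_norm_n n x = sq_norm2 n x / real n"

definition fused_lasso_objective ::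
  "nat \<Rightarrow> nat set set \<Rightarrow> (nat set \<Rightarrow> nat) \<Rightarrow> (nat set \<Rightarrow> nat) \<Rightarrow> real \<Rightarrow>
     (nat \<Rightarrow> real) \<Rightarrow> (nat \<Rightarrow> real) \<Rightarrow> real" where
  "fused_lasso_objective n E ep em lam y \<theta> =
     1 / 2 * sq_norm2 n (\<lambda>i. y i - \<theta> i) + lam * nabla_norm1 E ep em \<theta>"

definition fused_lasso ::
  "nat \<Rightarrow> nat set set \<Rightarrow> (nat set \<Rightarrow> nat) \<Rightarrow> (nat set \<Rightarrow> nat) \<Rightarrow> real \<Rightarrow>
     (nat \<Rightarrow> real) \<Rightarrow> nat \<Rightarrow> real" where
  "fused_lasso n E ep em lam y =
     arg_min (fused_lasso_objective n E ep em lam y) (\<lambda>\<theta>. \<theta> \<in> Rn n)"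

(* Mean-zero sub-Gaussian real random variable on the probability space P, with constants K, s. *)
definition sub_Gaussian :: "'a measure \<Rightarrow> ('a \<Rightarrow> real) \<Rightarrow> real \<Rightarrow> real \<Rightarrow> bool" where
  "sub_Gaussian P X K s \<longleftrightarrow>
     integrable P X \<and> integral\<^sup>L P X = 0 \<and>
     (\<forall>u\<ge>0. measure P {\<omega> \<in> space P. \<bar>X \<omega>\<bar> > u} \<le> K * exp (- u\<^sup>2 / (2 * s\<^sup>2)))"

(* A n = O_P(B n), where A n is a random variable on P n: the ratios A n / B n are bounded in
   probability.  Measurability is part of the notion because a non-measurable event would have
   measure 0 and so satisfy the bound vacuously; the inequality is multiplied out to avoid
   division by zero. *)
definition bigo_prob :: "(nat \<Rightarrow> 'a measure) \<Rightarrow> (nat \<Rightarrow> 'a \<Rightarrow> real) \<Rightarrow> (nat \<Rightarrow> real) \<Rightarrow> bool" where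
  "bigo_prob P A B \<longleftrightarrow>
     (\<forall>\<^sub>F n in sequentially. A n \<in> borel_measurable (P n)) \<and>
     (\<forall>\<delta>>0. \<exists>C>0. \<forall>\<^sub>F n in sequentially.
        measure (P n) {\<omega> \<in> space (P n). \<bar>A n \<omega>\<bar> > C * \<bar>B n\<bar>} \<le> \<delta>)"

end

(* Along a suitable ordering of the vertices, the total variation of any vector is at most twice its
   variation over the graph, so it suffices to control the noise along a chain.

   The noise is paired with a vector of chain variation v through Haar coefficients.  Haar
   coefficients of the noise below a level-dependent threshold are charged to v; what exceeds the
   threshold, together with all coefficients at scales above 2^l, is charged to the squared norm of
   the vector, and its expectation is of order n / 2^l because normalized noise coefficients have
   bounded eighth moments.  With 2^l of the order of lam^2, the v-term is absorbed by the penalty, and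
   no logarithmic factor arises since no union bound over the coefficients is taken.

   Measurability of the estimator holds because the minimizer is a Lipschitz function of the data. *)

theory Submission
  imports Defs
begin

subsection \<open>Ordering the vertices of a connected graph\<close>

text \<open>The obstacle: charging all noise to the variation requires the largest Haar coefficient,
  which grows with log n. At distance d = l - k below the cut-off, the threshold is q = 2^(d/4), and
  two sums constrain it. The variation charge q * 2^(k/2) = 2^(l/2) * 2^(-d/4) has to be summable in
  d. The part of a coefficient z beyond q is at most z^4 / q^3, and Young's inequality squares it to
  z^8 / q^6, hence the eighth moments; with 2^m / 2^(k+1) coefficients on the level, the expected
  total is of order 2^m / 2^l * 2^(-d/2), again summable. The rate comes from balancing the noise n
  / lam^2 against the penalty lam * t: lam^3 is of order n / t, and both are then of order t^(2/3)
  n^(1/3). The mean of the noise adds a further constant, which a penalty on differences cannot see;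
  \<open>t_lower\<close> says exactly that this constant is at most of that order.\<close>

fun chain_variation :: "('v \<Rightarrow> real) \<Rightarrow> 'v list \<Rightarrow> real" where
  "chain_variation \<theta> (x # y # zs) = \<bar>\<theta> y - \<theta> x\<bar> + chain_variation \<theta> (y # zs)"
| "chain_variation \<theta> _ = 0"

text \<open>Only the jump from \<open>u\<close> to its successor changes; by the triangle inequality
  the detour through \<open>v\<close> adds at most a trip from \<open>u\<close> to \<open>v\<close>
  and back.\<close>

lemma chain_variation_insert:
  "chain_variation \<theta> (xs @ u # v # ys) \<le> chain_variation \<theta> (xs @ u # ys) + 2 * \<bar>\<theta> u - \<theta> v\<bar>"
proof (induction xs rule: induct_list012)
  case 1
  show ?case by (cases ys) (auto simp: abs_if)
next
  case (2 x)
  show ?case by (cases ys) (auto simp: abs_if)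
next
  case (3 x y zs)
  then show ?case by simp
qed

lemma chain_variation_conv_sum:
  "chain_variation \<theta> xs = (\<Sum>i<length xs - 1. \<bar>\<theta> (xs ! Suc i) - \<theta> (xs ! i)\<bar>)"
proof (induction \<theta> xs rule: chain_variation.induct)
  case (1 \<theta> x y zs)
  then show ?case
    by (simp add: sum.lessThan_Suc_shift del: sum.lessThan_Suc)
qed auto

text \<open>A walk that starts in \<open>S\<close> and ends outside has to leave \<open>S\<close>
  along one of its edges.\<close>

lemma crossing_edge:
  assumes "connected_graph V E" and "S \<subseteq> V" and "S \<noteq> {}" and "S \<noteq> V"
  obtains u v where "{u, v} \<in> E" "u \<in> S" "v \<in> V - S"
proof -
  obtain a b where a: "a \<in> S" and b: "b \<in> V" "b \<notin> S" using assms(2-4) by blast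
  let ?R = "{(x, y). {x, y} \<in> E}"
  have "(a, b) \<in> ?R\<^sup>*" using assms a b unfolding connected_graph_def by blast
  then have "b \<notin> S \<longrightarrow> (\<exists>u v. {u, v} \<in> E \<and> u \<in> S \<and> v \<notin> S)"
    by (induction rule: rtrancl_induct) (use a in auto)
  moreover have "e \<subseteq> V" if "e \<in> E" for e
    using assms(1) that unfolding connected_graph_def by blast
  ultimately show thesis using that b by blast
qed

text \<open>The depth-first-search order of the paper is replaced by a greedy one: each new vertex is placed
  right behind a neighbour that is already listed, which costs at most twice the jump across their edge.\<close>

lemma connected_graph_chain:
  assumes G: "connected_graph V E" and O: "edge_orientation E ep em"
  shows "\<exists>xs. distinct xs \<and> set xs = V \<and>
    (\<forall>\<theta>. chain_variation \<theta> xs \<le> 2 * nabla_norm1 E ep em \<theta>)"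
proof -
  have EV: "e \<subseteq> V" if "e \<in> E" for e
    using G that unfolding connected_graph_def by auto
  have V: "finite V" "V \<noteq> {}" using G unfolding connected_graph_def by auto
  have finE: "finite E" by (rule finite_subset[of _ "Pow V"]) (use EV V in auto)
  \<comment> \<open>\<open>F\<close> records the edges already paid for. They join listed vertices
    only, so the edge to a new vertex is not among them and no edge is charged twice.\<close>
  have "\<exists>xs F. distinct xs \<and> set xs \<subseteq> V \<and> length xs = Suc k \<and> F \<subseteq> E \<and> (\<forall>e\<in>F. e \<subseteq> set xs) \<and>
     (\<forall>\<theta>. chain_variation \<theta> xs \<le> 2 * nabla_norm1 F ep em \<theta>)" if "Suc k \<le> card V" for k
    using that
  proof (induction k)
    case 0
    from V obtain r where "r \<in> V" by blast
    then show ?case by (intro exI[of _ "[r]"] exI[of _ "{}"]) (simp add: nabla_norm1_def)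
  next
    case (Suc k)
    then obtain xs F where xs: "distinct xs" "set xs \<subseteq> V" "length xs = Suc k" "F \<subseteq> E"
      "\<And>e. e \<in> F \<Longrightarrow> e \<subseteq> set xs" "\<And>\<theta>. chain_variation \<theta> xs \<le> 2 * nabla_norm1 F ep em \<theta>"
      by (auto simp: Suc_le_eq)
    have "set xs \<noteq> V" using Suc.prems xs distinct_card by fastforce
    moreover have "set xs \<noteq> {}" using xs(3) by auto
    ultimately obtain u v where uv: "{u, v} \<in> E" "u \<in> set xs" "v \<in> V - set xs"
      using crossing_edge[OF G xs(2)] by blast
    from uv obtain as bs where split: "xs = as @ u # bs" by (meson split_list)
    have new: "{u, v} \<notin> F" using xs(5) uv by blast
    have finF: "finite F" using xs(4) finE finite_subset by blast
    have jump: "\<bar>nabla ep em \<theta> {u, v}\<bar> = \<bar>\<theta> u - \<theta> v\<bar>" for \<theta>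
    proof -
      define e where "e = {u, v}"
      have "e = {ep e, em e}"
        by (rule bspec[OF O[unfolded edge_orientation_def]]) (use uv(1) e_def in simp)
      then have "{u, v} = {ep e, em e}" by (simp only: e_def[symmetric])
      then have "u = ep e \<and> v = em e \<or> u = em e \<and> v = ep e" by (simp only: doubleton_eq_iff)
      then have "\<bar>nabla ep em \<theta> e\<bar> = \<bar>\<theta> u - \<theta> v\<bar>" unfolding nabla_def by auto
      then show ?thesis unfolding e_def .
    qed
    show ?case
    proof (intro exI[of _ "as @ u # v # bs"] exI[of _ "insert {u, v} F"] conjI allI)
      fix \<theta>
      have "chain_variation \<theta> (as @ u # v # bs) \<le> chain_variation \<theta> xs + 2 * \<bar>\<theta> u - \<theta> v\<bar>"
        unfolding split by (rule chain_variation_insert)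
      also have "\<dots> \<le> 2 * nabla_norm1 (insert {u, v} F) ep em \<theta>"
        using xs(6)[of \<theta>] new finF jump[of \<theta>] by (simp add: nabla_norm1_def)
      finally show "chain_variation \<theta> (as @ u # v # bs) \<le> 2 * nabla_norm1 (insert {u, v} F) ep em \<theta>" .
    qed (use xs uv split in auto)
  qed
  from this[of "card V - 1"] V obtain xs F where xs: "distinct xs" "set xs \<subseteq> V" "length xs = card V"
    "F \<subseteq> E" "\<And>\<theta>. chain_variation \<theta> xs \<le> 2 * nabla_norm1 F ep em \<theta>"
    by (auto simp: card_gt_0_iff)
  show ?thesis
  proof (intro exI[of _ xs] conjI allI)
    show "set xs = V" using xs V by (metis card_subset_eq distinct_card)
    fix \<theta>
    have "nabla_norm1 F ep em \<theta> \<le> nabla_norm1 E ep em \<theta>"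
      unfolding nabla_norm1_def by (rule sum_mono2) (use xs finE in auto)
    then show "chain_variation \<theta> xs \<le> 2 * nabla_norm1 E ep em \<theta>" using xs(5)[of \<theta>] by linarith
  qed (use xs in auto)
qed

subsection \<open>Haar coefficients and chain variation\<close>

definition dyadic_sum :: "(nat \<Rightarrow> real) \<Rightarrow> nat \<Rightarrow> nat \<Rightarrow> real" where
  "dyadic_sum f k j = (\<Sum>i<2^k. f (j * 2^k + i))"

text \<open>Inner product with the discrete Haar wavelet of unit Euclidean norm on the
  \<open>j\<close>-th block of length 2^(k+1); small \<open>k\<close> means fine scale.\<close>

definition haar :: "(nat \<Rightarrow> real) \<Rightarrow> nat \<Rightarrow> nat \<Rightarrow> real" where
  "haar f k j = (dyadic_sum f k (2 * j) - dyadic_sum f k (2 * j + 1)) / sqrt (2 ^ Suc k)"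

lemma dyadic_sum_Suc:
  "dyadic_sum f (Suc k) j = dyadic_sum f k (2 * j) + dyadic_sum f k (2 * j + 1)"
proof -
  have split: "(\<Sum>i<a + b. h i) = (\<Sum>i<a. h i) + (\<Sum>i<b. h (a + i))" for a b and h :: "nat \<Rightarrow> real"
    by (induction b) auto
  have "dyadic_sum f (Suc k) j = (\<Sum>i<2^k + 2^k. f (j * 2 ^ Suc k + i))"
    by (simp add: dyadic_sum_def mult_2)
  also have "\<dots> = dyadic_sum f k (2 * j) + dyadic_sum f k (2 * j + 1)"
    unfolding split by (simp add: dyadic_sum_def algebra_simps)
  finally show ?thesis .
qed

text \<open>For sibling block sums this is x x' + y y' = ((x + y)(x' + y') + (x - y)(x' - y')) /
  2.\<close>

lemma haar_identity_step:
  "(\<Sum>j<2 * M. dyadic_sum f k j * dyadic_sum g k j) / 2 ^ k =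
   (\<Sum>j<M. dyadic_sum f (Suc k) j * dyadic_sum g (Suc k) j) / 2 ^ Suc k +
   (\<Sum>j<M. haar f k j * haar g k j)"
proof (induction M)
  case (Suc M)
  have *: "haar f k M * haar g k M = (dyadic_sum f k (2 * M) - dyadic_sum f k (2 * M + 1)) *
      (dyadic_sum g k (2 * M) - dyadic_sum g k (2 * M + 1)) / 2 ^ Suc k"
    unfolding haar_def times_divide_times_eq real_sqrt_mult_self by simp
  have **: "dyadic_sum f k (2 * M) * dyadic_sum g k (2 * M) / 2 ^ k +
      dyadic_sum f k (Suc (2 * M)) * dyadic_sum g k (Suc (2 * M)) / 2 ^ k =
      dyadic_sum f (Suc k) M * dyadic_sum g (Suc k) M / (2 * 2 ^ k) + haar f k M * haar g k M"
    unfolding * dyadic_sum_Suc by (simp add: field_simps)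
  show ?case
    using Suc ** by (simp add: add_divide_distrib add_divide_distrib)
qed simp

text \<open>Parseval's identity for the Haar basis on 2^m points, by iterating the previous step
  over the scales. It is used for the pairing of noise and signal and, with both arguments equal,
  for the squared norm.\<close>

lemma haar_identity:
  "(\<Sum>p<2^m. f p * g p) = dyadic_sum f m 0 * dyadic_sum g m 0 / 2 ^ m +
     (\<Sum>k<m. \<Sum>j<2^(m - Suc k). haar f k j * haar g k j)"
proof -
  have "(\<Sum>p<2^m. f p * g p) =
     (\<Sum>j<2^(m - r). dyadic_sum f r j * dyadic_sum g r j) / 2 ^ r +
     (\<Sum>k<r. \<Sum>j<2^(m - Suc k). haar f k j * haar g k j)" if "r \<le> m" for r
    using that
  proof (induction r)
    case 0
    then show ?case by (simp add: dyadic_sum_def)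
  next
    case (Suc r)
    have "(2::nat) ^ (m - r) = 2 * 2 ^ (m - Suc r)"
      using Suc.prems by (metis Suc_diff_Suc Suc_le_eq power_Suc)
    with Suc haar_identity_step[of f r g "2 ^ (m - Suc r)"] show ?case by simp
  qed
  from this[of m] show ?thesis by (simp add: lessThan_Suc)
qed

text \<open>Entry \<open>i\<close> of the left half of a block is paired with entry \<open>i\<close>
  of the right half. Each of the 2^k differences is at most the variation inside the block, the
  normalisation removes a factor of at least 2^(k/2), and the blocks of one level are
  disjoint.\<close>

lemma sum_abs_haar_le:
  "(\<Sum>j<M. \<bar>haar g k j\<bar>) \<le> sqrt (2 ^ k) * (\<Sum>p<M * 2 ^ Suc k. \<bar>g (Suc p) - g p\<bar>)"
proof -
  define d where "d p = \<bar>g (Suc p) - g p\<bar>" for p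
  have d: "\<bar>g (a + s) - g a\<bar> \<le> sum d {a..<a + s}" for a s
    by (induction s) (auto simp: d_def)
  have haar: "\<bar>haar g k j\<bar> \<le> sqrt (2 ^ k) * sum d {j * 2 ^ Suc k..<j * 2 ^ Suc k + 2 ^ Suc k}"
    (is "_ \<le> _ * ?T") for j
  proof -
    have "\<bar>dyadic_sum g k (2 * j) - dyadic_sum g k (2 * j + 1)\<bar> \<le>
        (\<Sum>i<2^k. \<bar>g ((2 * j) * 2^k + i) - g ((2 * j + 1) * 2^k + i)\<bar>)"
      unfolding dyadic_sum_def sum_subtractf[symmetric] by (rule sum_abs)
    also have "\<dots> \<le> (\<Sum>i<(2::nat)^k. ?T)"
    proof (rule sum_mono)
      fix i :: nat assume i: "i \<in> {..<2 ^ k}"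
      have "\<bar>g ((2 * j) * 2^k + i) - g ((2 * j + 1) * 2^k + i)\<bar> \<le>
          sum d {(2 * j) * 2^k + i..<(2 * j) * 2^k + i + 2^k}"
        using d[of "(2 * j) * 2^k + i" "2^k"] by (simp add: algebra_simps abs_minus_commute)
      also have "\<dots> \<le> ?T"
        by (rule sum_mono2) (use i in \<open>auto simp: d_def algebra_simps\<close>)
      finally show "\<bar>g ((2 * j) * 2^k + i) - g ((2 * j + 1) * 2^k + i)\<bar> \<le> ?T" .
    qed
    also have "\<dots> = 2 ^ k * ?T" by simp
    finally have 1: "\<bar>dyadic_sum g k (2 * j) - dyadic_sum g k (2 * j + 1)\<bar> \<le> 2 ^ k * ?T" .
    have "\<bar>haar g k j\<bar> \<le> 2 ^ k * ?T / sqrt (2 ^ Suc k)"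
      unfolding haar_def abs_divide using 1 by (simp add: divide_right_mono)
    also have "\<dots> \<le> 2 ^ k * ?T / sqrt (2 ^ k)"
      by (intro divide_left_mono mult_nonneg_nonneg sum_nonneg) (auto simp: d_def)
    also have "\<dots> = sqrt (2 ^ k) * ?T"
      by (simp add: real_div_sqrt flip: times_divide_eq_left)
    finally show ?thesis .
  qed
  have "(\<Sum>j<M. \<bar>haar g k j\<bar>) \<le> (\<Sum>j<M. sqrt (2 ^ k) * sum d {j * 2 ^ Suc k..<j * 2 ^ Suc k + 2 ^ Suc k})"
    by (intro sum_mono haar)
  also have "\<dots> = sqrt (2 ^ k) * sum d {..<M * 2 ^ Suc k}"
    by (simp only: sum_distrib_left[symmetric] sum.nat_group)
  finally show ?thesis by (simp add: d_def)
qed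

section \<open>Level-dependent thresholds\<close>

definition qrt2 :: real where "qrt2 = sqrt (sqrt 2)"

text \<open>The value 7/6 is good enough for both geometric sums: 1 / (\<open>qrt2\<close> - 1) is
  at most 6, and (7/6)^6 still exceeds 5/2.\<close>

lemma qrt2_ge: "qrt2 \<ge> 7/6"
  unfolding qrt2_def by (intro real_le_rsqrt) (simp add: power2_eq_square)

lemma qrt2_power_even: "qrt2 ^ (2 * k) = sqrt (2 ^ k)"
  by (simp add: qrt2_def power_mult real_sqrt_power)

text \<open>The threshold at level \<open>k < l\<close> is \<open>2 powr ((l - k) / 4)\<close>: it grows fast enough towards the fine
  levels for the excess to be summable, and slowly enough for the variation term to be.\<close>

definition haar_excess :: "nat \<Rightarrow> nat \<Rightarrow> (nat \<Rightarrow> real) \<Rightarrow> real" where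
  "haar_excess m l f = (dyadic_sum f m 0 / sqrt (2 ^ m))\<^sup>2 +
     (\<Sum>k<m. \<Sum>j<2^(m - Suc k).
        if k < l then haar f k j ^ 8 / qrt2 ^ (6 * (l - k)) else (haar f k j)\<^sup>2)"

text \<open>The terms are qrt2^l * qrt2^k, a geometric series dominated by the levels near
  \<open>l\<close>. The \<open>- 1\<close> makes the bound vanish at \<open>l = 0\<close>, which
  later admits arbitrarily small \<open>lam\<close>.\<close>

lemma sum_threshold_le:
  "(\<Sum>k<m. if k < l then qrt2 ^ (l - k) * sqrt (2 ^ k) else 0) \<le> 6 * (sqrt (2 ^ l) - 1)"
proof -
  have "(\<Sum>k<m. if k < l then qrt2 ^ (l - k) * sqrt (2 ^ k) else 0) =
      (\<Sum>k\<in>{..<m} \<inter> {..<l}. qrt2 ^ (l - k) * sqrt (2 ^ k))"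
    by (simp add: sum.inter_restrict)
  also have "\<dots> \<le> (\<Sum>k<l. qrt2 ^ (l - k) * sqrt (2 ^ k))"
    by (rule sum_mono2) (use qrt2_ge in auto)
  also have "\<dots> = qrt2 ^ l * (\<Sum>k<l. qrt2 ^ k)"
    unfolding sum_distrib_left
  proof (rule sum.cong)
    fix k assume "k \<in> {..<l}"
    then have "l - k + 2 * k = l + k" by simp
    then show "qrt2 ^ (l - k) * sqrt (2 ^ k) = qrt2 ^ l * qrt2 ^ k"
      by (metis power_add qrt2_power_even)
  qed simp
  also have "\<dots> = qrt2 ^ l * ((qrt2 ^ l - 1) / (qrt2 - 1))"
    using qrt2_ge by (subst geometric_sum) auto
  also have "\<dots> \<le> qrt2 ^ l * ((qrt2 ^ l - 1) / (1 / 6))"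
    using qrt2_ge by (intro mult_left_mono divide_left_mono) (auto simp: one_le_power)
  also have "\<dots> = 6 * (qrt2 ^ (2 * l) - qrt2 ^ l)"
    by (simp add: algebra_simps mult_2 mult_2_right power_add)
  also have "\<dots> \<le> 6 * (sqrt (2 ^ l) - 1)"
    using qrt2_ge by (simp add: qrt2_power_even one_le_power)
  finally show ?thesis .
qed

text \<open>Coefficientwise Young inequality after Parseval. The weight 1/8 is chosen because
  reflecting the chain doubles the squared norm; the resulting 1/4 then leaves half of the 1/2 in
  the basic inequality of the estimator.\<close>

lemma sum_mult_le_variation_plus_excess:
  "(\<Sum>p<2^m. f p * g p) \<le> (\<Sum>p<2^m. (g p)\<^sup>2) / 8 +
     6 * (sqrt (2 ^ l) - 1) * (\<Sum>p<2^m. \<bar>g (Suc p) - g p\<bar>) + 2 * haar_excess m l f"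
proof -
  define V where "V = (\<Sum>p<2^m. \<bar>g (Suc p) - g p\<bar>)"
  have V0: "V \<ge> 0" unfolding V_def by (intro sum_nonneg) auto
  define a where "a k = (if k < l then qrt2 ^ (l - k) else 0)" for k
  define w where "w k z = (if k < l then z ^ 8 / qrt2 ^ (6 * (l - k)) else z\<^sup>2)" for k and z :: real
  have young: "x * u \<le> x\<^sup>2 / 8 + 2 * u\<^sup>2" for x u :: real
    using zero_le_power2[of "x / 4 - u"] by (simp add: power2_eq_square algebra_simps)
  have coeff: "z * x \<le> x\<^sup>2 / 8 + a k * \<bar>x\<bar> + 2 * w k z" for k and x z :: real
  proof (cases "k < l")
    case True
    define q where "q = qrt2 ^ (l - k)"
    have q: "q > 0" unfolding q_def using qrt2_ge by simp
    \<comment> \<open>The first summand covers coefficients below the threshold, the second those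
      above it; squaring the second gives the eighth power in \<open>haar_excess\<close>.\<close>
    have "\<bar>z\<bar> \<le> q + z ^ 4 / q ^ 3"
    proof (cases "\<bar>z\<bar> \<le> q")
      case True
      then show ?thesis using q by (simp add: add_increasing2)
    next
      case False
      then have "\<bar>z\<bar> * q ^ 3 \<le> \<bar>z\<bar> * \<bar>z\<bar> ^ 3"
        using q by (intro mult_left_mono power_mono) auto
      also have "\<dots> = z ^ 4" by (simp add: power_even_abs flip: power_Suc)
      finally show ?thesis using q by (simp add: field_simps add_increasing2)
    qed
    then have "\<bar>z\<bar> * \<bar>x\<bar> \<le> (q + z ^ 4 / q ^ 3) * \<bar>x\<bar>" by (rule mult_right_mono) simp
    moreover have "z * x \<le> \<bar>z\<bar> * \<bar>x\<bar>" by (metis abs_ge_self abs_mult)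
    moreover have "(z ^ 4 / q ^ 3)\<^sup>2 = w k z"
      using True by (simp add: w_def q_def power_divide mult.commute flip: power_mult)
    ultimately show ?thesis
      using young[of "\<bar>x\<bar>" "z ^ 4 / q ^ 3"] True by (simp add: a_def q_def algebra_simps)
  next
    case False
    then show ?thesis using young[of x z] by (simp add: a_def w_def mult.commute)
  qed
  have level: "(\<Sum>j<2^(m - Suc k). a k * \<bar>haar g k j\<bar>) \<le> a k * sqrt (2 ^ k) * V" if "k < m" for k
  proof -
    have "(\<Sum>j<2^(m - Suc k). \<bar>haar g k j\<bar>) \<le> sqrt (2 ^ k) * V"
      using sum_abs_haar_le[of g k "2 ^ (m - Suc k)"] that
      by (simp add: V_def flip: power_add power_Suc)
    then show ?thesis
      using qrt2_ge by (simp add: a_def mult.assoc mult_left_mono flip: sum_distrib_left)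
  qed
  have "(\<Sum>p<2^m. f p * g p) = dyadic_sum f m 0 / sqrt (2 ^ m) * (dyadic_sum g m 0 / sqrt (2 ^ m)) +
     (\<Sum>k<m. \<Sum>j<2^(m - Suc k). haar f k j * haar g k j)"
    unfolding haar_identity[of f g m] by simp
  also have "\<dots> \<le> ((dyadic_sum g m 0 / sqrt (2 ^ m))\<^sup>2 / 8 + 2 * (dyadic_sum f m 0 / sqrt (2 ^ m))\<^sup>2) +
     (\<Sum>k<m. \<Sum>j<2^(m - Suc k). (haar g k j)\<^sup>2 / 8 + a k * \<bar>haar g k j\<bar> + 2 * w k (haar f k j))"
    using young[of "dyadic_sum g m 0 / sqrt (2 ^ m)" "dyadic_sum f m 0 / sqrt (2 ^ m)"]
    by (intro add_mono sum_mono coeff) (simp only: mult.commute)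
  also have "\<dots> = ((dyadic_sum g m 0 / sqrt (2 ^ m))\<^sup>2 +
       (\<Sum>k<m. \<Sum>j<2^(m - Suc k). (haar g k j)\<^sup>2)) / 8 +
     (\<Sum>k<m. \<Sum>j<2^(m - Suc k). a k * \<bar>haar g k j\<bar>) + 2 * haar_excess m l f"
    by (simp add: haar_excess_def w_def sum.distrib sum_divide_distrib sum_distrib_left
        add_divide_distrib algebra_simps)
  also have "(dyadic_sum g m 0 / sqrt (2 ^ m))\<^sup>2 + (\<Sum>k<m. \<Sum>j<2^(m - Suc k). (haar g k j)\<^sup>2) =
      (\<Sum>p<2^m. (g p)\<^sup>2)"
    using haar_identity[of g g m] by (simp add: power2_eq_square)
  also have "(\<Sum>k<m. \<Sum>j<2^(m - Suc k). a k * \<bar>haar g k j\<bar>) \<le> (\<Sum>k<m. a k * sqrt (2 ^ k)) * V"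
    unfolding sum_distrib_right by (intro sum_mono level) auto
  also have "\<dots> \<le> 6 * (sqrt (2 ^ l) - 1) * V"
    using sum_threshold_le[of l m] V0
    by (intro mult_right_mono) (auto simp: a_def if_distrib[of "\<lambda>x. x * _"] cong: if_cong)
  finally show ?thesis by (simp add: V_def)
qed

subsection \<open>Moments of linear combinations of sub-Gaussian variables\<close>

definition exp_moment_bound :: "real \<Rightarrow> real \<Rightarrow> real" where
  "exp_moment_bound K s = exp 2 + K * exp (2 + 9 * s\<^sup>2 / 2) / (1 - exp (-1))"

text \<open>Cut into the layers m < |X| <= m + 1: there the integrand is at most exp(2(m + 1)), and
  the Gaussian tail turns the layer sum into a geometric series of ratio exp(-1).\<close>

lemma sub_Gaussian_exp_moment:
  assumes P: "prob_space P" and X: "sub_Gaussian P X K s" and pos: "K > 0" "s > 0"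
  shows "integrable P (\<lambda>\<omega>. exp (2 * \<bar>X \<omega>\<bar>))"
    and "(\<integral>\<omega>. exp (2 * \<bar>X \<omega>\<bar>) \<partial>P) \<le> exp_moment_bound K s"
proof -
  interpret prob_space P by (rule P)
  have [measurable]: "X \<in> borel_measurable P" using X unfolding sub_Gaussian_def by auto
  define A where "A m = {\<omega> \<in> space P. \<bar>X \<omega>\<bar> > real m}" for m :: nat
  have [measurable]: "A m \<in> sets P" for m unfolding A_def by measurable
  have pA: "measure P (A m) \<le> K * exp (- (real m)\<^sup>2 / (2 * s\<^sup>2))" for m
    using X unfolding sub_Gaussian_def A_def by auto
  define B where "B = exp (2 + 9 * s\<^sup>2 / 2)"
  have term_le: "exp (2 * (real m + 1)) * measure P (A m) \<le> K * B * exp (-1) ^ m" for m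
  proof -
    \<comment> \<open>The square is completed for the linear term 3m: 2m for the integrand and one
      more m to retain the decay exp(-m).\<close>
    have "0 \<le> (real m - 3 * s\<^sup>2)\<^sup>2 / (2 * s\<^sup>2)" by simp
    also have "\<dots> = (real m)\<^sup>2 / (2 * s\<^sup>2) - 3 * real m + 9 * s\<^sup>2 / 2"
      using pos by (simp add: power2_eq_square field_simps)
    finally have "2 * (real m + 1) + (- (real m)\<^sup>2 / (2 * s\<^sup>2)) \<le> (2 + 9 * s\<^sup>2 / 2) + - real m"
      by simp
    then have "exp (2 * (real m + 1)) * exp (- (real m)\<^sup>2 / (2 * s\<^sup>2)) \<le> B * exp (- real m)"
      unfolding B_def by (simp only: exp_add[symmetric] exp_le_cancel_iff)
    then have bd: "K * (exp (2 * (real m + 1)) * exp (- (real m)\<^sup>2 / (2 * s\<^sup>2))) \<le> K * (B * exp (- real m))"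
      using pos by (intro mult_left_mono) auto
    have "exp (2 * (real m + 1)) * measure P (A m) \<le>
        exp (2 * (real m + 1)) * (K * exp (- (real m)\<^sup>2 / (2 * s\<^sup>2)))"
      by (intro mult_left_mono pA) auto
    also have "\<dots> = K * (exp (2 * (real m + 1)) * exp (- (real m)\<^sup>2 / (2 * s\<^sup>2)))"
      by (simp only: mult_ac)
    also note bd
    also have "K * (B * exp (- real m)) = K * B * exp (-1) ^ m"
      by (simp flip: exp_of_nat_mult)
    finally show ?thesis .
  qed
  have le_suminf: "h m \<le> suminf h" for h :: "nat \<Rightarrow> ennreal" and m
    using sum_le_suminf[OF summableI, of "{m}" h] by simp
  have pw: "ennreal (exp (2 * \<bar>X \<omega>\<bar>)) \<le>
      ennreal (exp 2) + (\<Sum>m. ennreal (exp (2 * (real m + 1))) * indicator (A m) \<omega>)"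
    if "\<omega> \<in> space P" for \<omega>
  proof (cases "X \<omega> = 0")
    case True
    then show ?thesis by (simp add: add_increasing2 flip: ennreal_1)
  next
    case False
    \<comment> \<open>Ceiling minus one instead of floor, because \<open>A m\<close> asks for strict
      inequality also when |X| is an integer.\<close>
    define m where "m = nat (\<lceil>\<bar>X \<omega>\<bar>\<rceil> - 1)"
    have m: "real m < \<bar>X \<omega>\<bar>" "\<bar>X \<omega>\<bar> \<le> real m + 1"
      using False unfolding m_def by linarith+
    have "ennreal (exp (2 * \<bar>X \<omega>\<bar>)) \<le> ennreal (exp (2 * (real m + 1))) * indicator (A m) \<omega>"
      using m that by (simp add: A_def)
    also have "\<dots> \<le> (\<Sum>m. ennreal (exp (2 * (real m + 1))) * indicator (A m) \<omega>)"
      using le_suminf[of "\<lambda>m. ennreal (exp (2 * (real m + 1))) * indicator (A m) \<omega>" m] .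
    finally show ?thesis by (simp add: add_increasing)
  qed
  have geo: "(\<lambda>m. K * B * exp (-1) ^ m) sums (K * B * (1 / (1 - exp (-1))))"
    by (intro sums_mult geometric_sums) simp
  have "(\<integral>\<^sup>+\<omega>. ennreal (exp (2 * \<bar>X \<omega>\<bar>)) \<partial>P) \<le>
      (\<integral>\<^sup>+\<omega>. ennreal (exp 2) + (\<Sum>m. ennreal (exp (2 * (real m + 1))) * indicator (A m) \<omega>) \<partial>P)"
    by (intro nn_integral_mono pw)
  also have "\<dots> = ennreal (exp 2) + (\<Sum>m. ennreal (exp (2 * (real m + 1))) * emeasure P (A m))"
    by (subst nn_integral_add) (auto simp: nn_integral_suminf nn_integral_cmult_indicator emeasure_space_1)
  also have "(\<Sum>m. ennreal (exp (2 * (real m + 1))) * emeasure P (A m)) \<le>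
      (\<Sum>m. ennreal (K * B * exp (-1) ^ m))"
    by (intro suminf_le summableI)
       (simp only: emeasure_eq_measure term_le ennreal_leI flip: ennreal_mult'[OF exp_ge_zero])
  also have "\<dots> = ennreal (K * B * (1 / (1 - exp (-1))))"
    using pos by (intro suminf_ennreal_eq geo) (auto simp: B_def)
  also have "ennreal (exp 2) + \<dots> = ennreal (exp_moment_bound K s)"
    unfolding exp_moment_bound_def B_def using pos by (subst ennreal_plus[symmetric]) auto
  finally have nn: "(\<integral>\<^sup>+\<omega>. ennreal (exp (2 * \<bar>X \<omega>\<bar>)) \<partial>P) \<le> ennreal (exp_moment_bound K s)"
    by (simp add: add_left_mono)
  then have "(\<integral>\<^sup>+\<omega>. ennreal (exp (2 * \<bar>X \<omega>\<bar>)) \<partial>P) < \<infinity>"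
    by (simp add: le_less_trans[OF _ ennreal_less_top])
  then show int: "integrable P (\<lambda>\<omega>. exp (2 * \<bar>X \<omega>\<bar>))"
    by (intro integrableI_bounded) auto
  have "0 \<le> exp_moment_bound K s"
    unfolding exp_moment_bound_def using pos by (intro add_nonneg_nonneg divide_nonneg_nonneg) auto
  then show "(\<integral>\<omega>. exp (2 * \<bar>X \<omega>\<bar>) \<partial>P) \<le> exp_moment_bound K s"
    using nn nn_integral_eq_integral[OF int] by simp
qed

text \<open>The Taylor remainder contains exp(u) x^2 / 2 with u <= |x|, and x^2 / 2 <= exp |x|; this
  is the origin of the factor 2 in the exponential moment.\<close>

lemma exp_le_quadratic:
  fixes c x :: real
  assumes "\<bar>c\<bar> \<le> 1"
  shows "exp (c * x) \<le> 1 + c * x + c\<^sup>2 * exp (2 * \<bar>x\<bar>)"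
proof -
  obtain u where u: "\<bar>u\<bar> \<le> \<bar>c * x\<bar>" "exp (c * x) = 1 + c * x + exp u / 2 * (c * x)\<^sup>2"
    using Maclaurin_exp_le[of "c * x" 2] by (auto simp: numeral_2_eq_2)
  have "u \<le> \<bar>x\<bar>" using u(1) assms mult_right_mono[of "\<bar>c\<bar>" 1 "\<bar>x\<bar>"] by (simp add: abs_mult)
  then have "exp u * (x\<^sup>2 / 2) \<le> exp \<bar>x\<bar> * exp \<bar>x\<bar>"
    using exp_lower_Taylor_quadratic[of "\<bar>x\<bar>"] by (intro mult_mono) auto
  then have "c\<^sup>2 * (exp u * (x\<^sup>2 / 2)) \<le> c\<^sup>2 * exp (2 * \<bar>x\<bar>)"
    by (intro mult_left_mono) (auto simp flip: exp_add)
  then show ?thesis using u(2) by (simp add: power_mult_distrib mult_ac)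
qed

text \<open>The zero mean removes the linear term. An exponent quadratic in \<open>c\<close> is what
  allows products over independent variables to depend on the sum of squares only.\<close>

lemma sub_Gaussian_mgf:
  assumes P: "prob_space P" and X: "sub_Gaussian P X K s" and pos: "K > 0" "s > 0" and c: "\<bar>c\<bar> \<le> 1"
  shows "(\<integral>\<^sup>+\<omega>. ennreal (exp (c * X \<omega>)) \<partial>P) \<le> ennreal (exp (exp_moment_bound K s * c\<^sup>2))"
proof -
  interpret prob_space P by (rule P)
  have X': "integrable P X" "(\<integral>\<omega>. X \<omega> \<partial>P) = 0" using X unfolding sub_Gaussian_def by auto
  note ex = sub_Gaussian_exp_moment[OF P X pos]
  have int: "integrable P (\<lambda>\<omega>. 1 + c * X \<omega> + c\<^sup>2 * exp (2 * \<bar>X \<omega>\<bar>))"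
    using X' ex by auto
  have "(\<integral>\<^sup>+\<omega>. ennreal (exp (c * X \<omega>)) \<partial>P) \<le>
      (\<integral>\<^sup>+\<omega>. ennreal (1 + c * X \<omega> + c\<^sup>2 * exp (2 * \<bar>X \<omega>\<bar>)) \<partial>P)"
    by (intro nn_integral_mono ennreal_leI exp_le_quadratic c)
  also have "\<dots> = ennreal (\<integral>\<omega>. 1 + c * X \<omega> + c\<^sup>2 * exp (2 * \<bar>X \<omega>\<bar>) \<partial>P)"
    by (intro nn_integral_eq_integral int AE_I2)
       (meson exp_ge_zero exp_le_quadratic[OF c] order_trans)
  also have "(\<integral>\<omega>. 1 + c * X \<omega> + c\<^sup>2 * exp (2 * \<bar>X \<omega>\<bar>) \<partial>P) = 1 + c\<^sup>2 * (\<integral>\<omega>. exp (2 * \<bar>X \<omega>\<bar>) \<partial>P)"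
    using X' ex by (simp add: prob_space)
  also have "ennreal \<dots> \<le> ennreal (1 + exp_moment_bound K s * c\<^sup>2)"
    using ex(2) by (intro ennreal_leI add_left_mono) (simp only: mult.commute[of _ "c\<^sup>2"] mult_left_mono zero_le_power2)
  also have "\<dots> \<le> ennreal (exp (exp_moment_bound K s * c\<^sup>2))"
    by (intro ennreal_leI exp_ge_add_one_self)
  finally show ?thesis .
qed

text \<open>A single term of the series of exp |z|.\<close>

lemma power8_le_exp:
  fixes z :: real
  shows "z ^ 8 \<le> fact 8 * (exp z + exp (- z))"
proof -
  have *: "(\<lambda>n. \<bar>z\<bar> ^ n /\<^sub>R fact n) sums exp \<bar>z\<bar>" by (rule exp_converges)
  have "(\<Sum>n\<in>{8}. \<bar>z\<bar> ^ n /\<^sub>R fact n) \<le> exp \<bar>z\<bar>"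
    unfolding sums_unique[OF *] by (rule sum_le_suminf[OF sums_summable[OF *]]) auto
  then have "\<bar>z\<bar> ^ 8 \<le> fact 8 * exp \<bar>z\<bar>" by (simp add: field_simps)
  moreover have "\<bar>z\<bar> ^ 8 = z ^ 8" by (simp add: power_even_abs)
  moreover have "exp \<bar>z\<bar> \<le> exp z + exp (- z)" by (cases "z \<ge> 0") auto
  ultimately show ?thesis by (smt (verit) fact_ge_zero mult_left_mono)
qed

definition eighth_moment_bound :: "real \<Rightarrow> real \<Rightarrow> real" where
  "eighth_moment_bound K s = fact 8 * (2 * exp (exp_moment_bound K s))"

section \<open>Moments uniform over normalised linear combinations\<close>

locale sub_Gaussian_family = prob_space P for P :: "'a measure" +
  fixes X :: "'i \<Rightarrow> 'a \<Rightarrow> real" and I :: "'i set" and K s :: real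
  assumes finite_index: "finite I"
    and independent: "indep_vars (\<lambda>_. borel) X I"
    and tails: "\<And>i. i \<in> I \<Longrightarrow> sub_Gaussian P (X i) K s"
    and K_pos: "K > 0" and s_pos: "s > 0"
begin

lemma measurable_X [measurable]: "i \<in> I \<Longrightarrow> X i \<in> borel_measurable P"
  using tails unfolding sub_Gaussian_def by auto

lemma exp_moment_bound_nonneg: "0 \<le> exp_moment_bound K s"
  unfolding exp_moment_bound_def using K_pos by (intro add_nonneg_nonneg divide_nonneg_nonneg) auto

lemma eighth_moment_bound_nonneg: "0 \<le> eighth_moment_bound K s"
  unfolding eighth_moment_bound_def by simp

text \<open>Independence factorises the integral and the exponents add up; the norm condition also
  forces each |c i| <= 1, as the single-variable bound requires.\<close>

lemma mgf_linear:
  assumes J: "J \<subseteq> I" and c: "(\<Sum>i\<in>J. (c i)\<^sup>2) \<le> 1"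
  shows "(\<integral>\<^sup>+\<omega>. ennreal (exp (\<Sum>i\<in>J. c i * X i \<omega>)) \<partial>P) \<le> ennreal (exp (exp_moment_bound K s))"
proof -
  have fin: "finite J" using J finite_index finite_subset by blast
  have c1: "\<bar>c i\<bar> \<le> 1" if "i \<in> J" for i
  proof -
    have "(c i)\<^sup>2 \<le> (\<Sum>i\<in>J. (c i)\<^sup>2)" by (rule member_le_sum) (use that fin in auto)
    with c have "(c i)\<^sup>2 \<le> 1" by linarith
    then show ?thesis by (simp add: abs_square_le_1)
  qed
  have ind: "indep_vars (\<lambda>_. borel) (\<lambda>i \<omega>. ennreal (exp (c i * X i \<omega>))) J"
    by (rule indep_vars_compose2[OF indep_vars_subset[OF independent J]]) simp
  have "(\<integral>\<^sup>+\<omega>. ennreal (exp (\<Sum>i\<in>J. c i * X i \<omega>)) \<partial>P) =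
      (\<integral>\<^sup>+\<omega>. (\<Prod>i\<in>J. ennreal (exp (c i * X i \<omega>))) \<partial>P)"
    by (simp add: exp_sum[OF fin] prod_ennreal)
  also have "\<dots> = (\<Prod>i\<in>J. \<integral>\<^sup>+\<omega>. ennreal (exp (c i * X i \<omega>)) \<partial>P)"
    by (rule indep_vars_nn_integral[OF fin ind]) simp
  also have "\<dots> \<le> (\<Prod>i\<in>J. ennreal (exp (exp_moment_bound K s * (c i)\<^sup>2)))"
    by (intro prod_mono_ennreal) (use J in \<open>auto intro!: sub_Gaussian_mgf tails c1 K_pos s_pos prob_space_axioms\<close>)
  also have "\<dots> = ennreal (exp (exp_moment_bound K s * (\<Sum>i\<in>J. (c i)\<^sup>2)))"
    by (simp add: prod_ennreal sum_distrib_left exp_sum[OF fin])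
  also have "\<dots> \<le> ennreal (exp (exp_moment_bound K s))"
    using c exp_moment_bound_nonneg by (intro ennreal_leI) (simp add: mult_left_le)
  finally show ?thesis .
qed

text \<open>Uses \<open>mgf_linear\<close> for \<open>c\<close> and for its negative. The bound is
  free of \<open>J\<close> and \<open>c\<close>, so all Haar coefficients share it.\<close>

lemma eighth_moment_linear:
  assumes J: "J \<subseteq> I" and c: "(\<Sum>i\<in>J. (c i)\<^sup>2) \<le> 1"
  shows "integrable P (\<lambda>\<omega>. (\<Sum>i\<in>J. c i * X i \<omega>) ^ 8)"
    and "(\<integral>\<omega>. (\<Sum>i\<in>J. c i * X i \<omega>) ^ 8 \<partial>P) \<le> eighth_moment_bound K s"
proof -
  define Z where "Z \<omega> = (\<Sum>i\<in>J. c i * X i \<omega>)" for \<omega>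
  have [measurable]: "Z \<in> borel_measurable P"
    unfolding Z_def using J by (intro borel_measurable_sum borel_measurable_times) auto
  have "(\<integral>\<^sup>+\<omega>. ennreal (exp (- Z \<omega>)) \<partial>P) = (\<integral>\<^sup>+\<omega>. ennreal (exp (\<Sum>i\<in>J. (- c i) * X i \<omega>)) \<partial>P)"
    by (simp add: Z_def sum_negf)
  also have "\<dots> \<le> ennreal (exp (exp_moment_bound K s))"
    by (rule mgf_linear[OF J]) (use c in simp)
  finally have neg: "(\<integral>\<^sup>+\<omega>. ennreal (exp (- Z \<omega>)) \<partial>P) \<le> ennreal (exp (exp_moment_bound K s))" .
  have "(\<integral>\<^sup>+\<omega>. ennreal (Z \<omega> ^ 8) \<partial>P) \<le>
      (\<integral>\<^sup>+\<omega>. ennreal (fact 8) * (ennreal (exp (Z \<omega>)) + ennreal (exp (- Z \<omega>))) \<partial>P)"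
  proof (rule nn_integral_mono)
    fix \<omega>
    have "ennreal (Z \<omega> ^ 8) \<le> ennreal (fact 8 * (exp (Z \<omega>) + exp (- Z \<omega>)))"
      by (intro ennreal_leI power8_le_exp)
    then show "ennreal (Z \<omega> ^ 8) \<le> ennreal (fact 8) * (ennreal (exp (Z \<omega>)) + ennreal (exp (- Z \<omega>)))"
      by (simp only: ennreal_mult' fact_ge_zero ennreal_plus exp_ge_zero)
  qed
  also have "\<dots> = ennreal (fact 8) *
      ((\<integral>\<^sup>+\<omega>. ennreal (exp (Z \<omega>)) \<partial>P) + (\<integral>\<^sup>+\<omega>. ennreal (exp (- Z \<omega>)) \<partial>P))"
    by (simp add: nn_integral_cmult nn_integral_add del: fact_numeral)
  also have "\<dots> \<le> ennreal (fact 8) *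
      (ennreal (exp (exp_moment_bound K s)) + ennreal (exp (exp_moment_bound K s)))"
    using mgf_linear[OF J c] neg by (intro mult_left_mono add_mono) (auto simp: Z_def)
  also have "\<dots> = ennreal (eighth_moment_bound K s)"
    unfolding eighth_moment_bound_def mult_2
    by (simp only: ennreal_mult' fact_ge_zero ennreal_plus exp_ge_zero)
  finally have nn: "(\<integral>\<^sup>+\<omega>. ennreal (Z \<omega> ^ 8) \<partial>P) \<le> ennreal (eighth_moment_bound K s)" .
  then have "(\<integral>\<^sup>+\<omega>. ennreal (Z \<omega> ^ 8) \<partial>P) < \<infinity>"
    by (simp add: le_less_trans[OF _ ennreal_less_top])
  then have int: "integrable P (\<lambda>\<omega>. Z \<omega> ^ 8)"
    by (intro integrableI_nonneg) auto
  then show "integrable P (\<lambda>\<omega>. (\<Sum>i\<in>J. c i * X i \<omega>) ^ 8)" by (simp add: Z_def)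
  have "(\<integral>\<omega>. Z \<omega> ^ 8 \<partial>P) \<le> eighth_moment_bound K s"
    using nn nn_integral_eq_integral[OF int] eighth_moment_bound_nonneg by simp
  then show "(\<integral>\<omega>. (\<Sum>i\<in>J. c i * X i \<omega>) ^ 8 \<partial>P) \<le> eighth_moment_bound K s" by (simp add: Z_def)
qed

lemma second_moment_linear:
  assumes J: "J \<subseteq> I" and c: "(\<Sum>i\<in>J. (c i)\<^sup>2) \<le> 1"
  shows "integrable P (\<lambda>\<omega>. (\<Sum>i\<in>J. c i * X i \<omega>)\<^sup>2)"
    and "(\<integral>\<omega>. (\<Sum>i\<in>J. c i * X i \<omega>)\<^sup>2 \<partial>P) \<le> 1 + eighth_moment_bound K s"
proof -
  note m8 = eighth_moment_linear[OF J c]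
  have sq: "z\<^sup>2 \<le> 1 + z ^ 8" for z :: real
  proof (cases "\<bar>z\<bar> \<le> 1")
    case True
    then have "z\<^sup>2 \<le> 1" by (simp add: abs_square_le_1)
    then show ?thesis by (simp add: add_increasing2)
  next
    case False
    then have "\<bar>z\<bar> ^ 2 \<le> \<bar>z\<bar> ^ 8" by (intro power_increasing) auto
    then show ?thesis by (simp add: power_even_abs)
  qed
  have [measurable]: "(\<lambda>\<omega>. \<Sum>i\<in>J. c i * X i \<omega>) \<in> borel_measurable P"
    using J by (intro borel_measurable_sum borel_measurable_times) auto
  show int: "integrable P (\<lambda>\<omega>. (\<Sum>i\<in>J. c i * X i \<omega>)\<^sup>2)"
    by (rule Bochner_Integration.integrable_bound[of _ "\<lambda>\<omega>. 1 + (\<Sum>i\<in>J. c i * X i \<omega>) ^ 8"])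
       (use m8 sq in auto)
  have "(\<integral>\<omega>. (\<Sum>i\<in>J. c i * X i \<omega>)\<^sup>2 \<partial>P) \<le> (\<integral>\<omega>. 1 + (\<Sum>i\<in>J. c i * X i \<omega>) ^ 8 \<partial>P)"
    by (intro integral_mono int sq) (use m8 in auto)
  then show "(\<integral>\<omega>. (\<Sum>i\<in>J. c i * X i \<omega>)\<^sup>2 \<partial>P) \<le> 1 + eighth_moment_bound K s"
    using m8 by (simp add: prob_space)
qed

end

subsection \<open>The fused lasso estimator\<close>

lemma sq_norm2_nonneg [simp]: "0 \<le> sq_norm2 n x"
  unfolding sq_norm2_def by (intro sum_nonneg) auto

lemma sq_norm2_parallelogram:
  "sq_norm2 n (\<lambda>i. y i - (a i + b i) / 2) =
     (sq_norm2 n (\<lambda>i. y i - a i) + sq_norm2 n (\<lambda>i. y i - b i)) / 2 - sq_norm2 n (\<lambda>i. a i - b i) / 4"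
  unfolding sq_norm2_def sum.distrib[symmetric] sum_divide_distrib sum_subtractf[symmetric]
  by (intro sum.cong) (auto simp: power2_eq_square field_simps)

lemma nabla_norm1_nonneg: "0 \<le> nabla_norm1 E ep em \<theta>"
  unfolding nabla_norm1_def by (intro sum_nonneg) auto

lemma nabla_norm1_cong:
  assumes "edge_orientation E ep em" "\<And>e. e \<in> E \<Longrightarrow> e \<subseteq> V" "\<And>i. i \<in> V \<Longrightarrow> \<theta> i = \<eta> i"
  shows "nabla_norm1 E ep em \<theta> = nabla_norm1 E ep em \<eta>"
proof -
  have "ep e \<in> V \<and> em e \<in> V" if "e \<in> E" for e
  proof -
    have "e = {ep e, em e}" by (rule bspec[OF assms(1)[unfolded edge_orientation_def] that])
    then have "{ep e, em e} \<subseteq> e" by (rule equalityD2)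
    then have "{ep e, em e} \<subseteq> V" using assms(2)[OF that] by (rule subset_trans)
    then show ?thesis by simp
  qed
  then show ?thesis unfolding nabla_norm1_def nabla_def by (intro sum.cong) (auto simp: assms(3))
qed

lemma nabla_norm1_midpoint:
  "nabla_norm1 E ep em (\<lambda>i. (a i + b i) / 2) \<le> (nabla_norm1 E ep em a + nabla_norm1 E ep em b) / 2"
  unfolding nabla_norm1_def sum.distrib[symmetric] sum_divide_distrib nabla_def
  by (intro sum_mono) (auto simp: abs_if field_simps)

lemma nabla_norm1_triangle:
  "nabla_norm1 E ep em (\<lambda>i. a i - b i) \<le> nabla_norm1 E ep em a + nabla_norm1 E ep em b"
  unfolding nabla_norm1_def sum.distrib[symmetric] nabla_def
  by (intro sum_mono) (auto simp: abs_if)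

text \<open>The extensional box is a product over all indices with the singleton of
  \<open>undefined\<close> outside \<open>{1..n}\<close>, so Tychonoff's theorem applies.\<close>

lemma compact_Rn_box: "compact ({1..n::nat} \<rightarrow>\<^sub>E {- R..R::real})"
proof -
  have *: "{1..n} \<rightarrow>\<^sub>E {- R..R::real} = PiE UNIV (\<lambda>i. if i \<in> {1..n} then {- R..R} else {undefined})"
    by (auto simp: PiE_iff extensional_def split: if_splits)
  have "compactin (product_topology (\<lambda>i::nat. euclidean) UNIV)
      (PiE UNIV (\<lambda>i. if i \<in> {1..n} then {- R..R} else {undefined::real}))"
    unfolding compactin_PiE by auto
  then show ?thesis unfolding * euclidean_product_topology compactin_euclidean_iff .
qed

section \<open>Existence, strong minimality and stability of the minimizer\<close>

locale fused_lasso_problem =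
  fixes n :: nat and E :: "nat set set" and ep em :: "nat set \<Rightarrow> nat" and lam :: real
  assumes edges: "\<And>e. e \<in> E \<Longrightarrow> e \<subseteq> {1..n}"
    and orient: "edge_orientation E ep em"
    and lam_nonneg: "lam \<ge> 0"
begin

abbreviation "objective \<equiv> fused_lasso_objective n E ep em lam"
abbreviation "estimator \<equiv> fused_lasso n E ep em lam"

text \<open>Makes competitors outside \<open>Rn n\<close>, such as midpoints with an arbitrary
  vector, admissible in comparisons with the minimizer.\<close>

lemma objective_restrict: "objective y (restrict \<theta> {1..n}) = objective y \<theta>"
proof -
  have "nabla_norm1 E ep em (restrict \<theta> {1..n}) = nabla_norm1 E ep em \<theta>"
    by (rule nabla_norm1_cong[OF orient edges]) auto
  then show ?thesis by (simp add: fused_lasso_objective_def sq_norm2_def)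
qed

lemma estimator_cong:
  assumes "\<And>i. i \<in> {1..n} \<Longrightarrow> y i = z i"
  shows "estimator y = estimator z"
proof -
  have "objective y = objective z"
    using assms by (auto simp: fused_lasso_objective_def sq_norm2_def)
  then show ?thesis by (simp add: fused_lasso_def)
qed

lemma continuous_objective: "continuous_on S (objective y)"
proof -
  have "continuous_on UNIV (objective y)"
    unfolding fused_lasso_objective_def sq_norm2_def nabla_norm1_def nabla_def
    by (intro continuous_intros continuous_on_product_coordinates)
  then show ?thesis by (rule continuous_on_subset) simp
qed

lemma minimizer_exists: "\<exists>\<theta>\<in>Rn n. \<forall>\<eta>\<in>Rn n. objective y \<theta> \<le> objective y \<eta>"
proof -
  define z where "z = restrict (\<lambda>_. 0 :: real) {1..n}"
  \<comment> \<open>Outside the box of radius \<open>R\<close>, some single residual already makes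
    the objective larger than at the zero vector \<open>z\<close>.\<close>
  define R where "R = (\<Sum>i=1..n. \<bar>y i\<bar>) + sqrt (2 * objective y z)"
  have ob0: "objective y \<theta> \<ge> 0" for \<theta>
    unfolding fused_lasso_objective_def
    by (intro add_nonneg_nonneg mult_nonneg_nonneg lam_nonneg nabla_norm1_nonneg) auto
  have R: "R \<ge> 0" unfolding R_def using ob0 by (intro add_nonneg_nonneg sum_nonneg) auto
  then have zB: "z \<in> {1..n} \<rightarrow>\<^sub>E {- R..R}" by (auto simp: z_def)
  then have "\<exists>\<theta>\<in>{1..n} \<rightarrow>\<^sub>E {- R..R}. \<forall>\<eta>\<in>{1..n} \<rightarrow>\<^sub>E {- R..R}. objective y \<theta> \<le> objective y \<eta>"
    by (intro continuous_attains_inf compact_Rn_box continuous_objective) auto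
  then obtain \<theta> where \<theta>: "\<theta> \<in> {1..n} \<rightarrow>\<^sub>E {- R..R}"
    "\<And>\<eta>. \<eta> \<in> {1..n} \<rightarrow>\<^sub>E {- R..R} \<Longrightarrow> objective y \<theta> \<le> objective y \<eta>" by blast
  have "objective y \<theta> \<le> objective y \<eta>" if \<eta>: "\<eta> \<in> Rn n" for \<eta>
  proof (cases "\<eta> \<in> {1..n} \<rightarrow>\<^sub>E {- R..R}")
    case False
    then obtain i where "i \<in> {1..n}" "\<eta> i \<notin> {- R..R}"
      using \<eta> unfolding Rn_def PiE_iff by blast
    then have i: "i \<in> {1..n}" "\<bar>\<eta> i\<bar> > R" by auto
    have "\<bar>y i\<bar> \<le> (\<Sum>i=1..n. \<bar>y i\<bar>)" by (rule member_le_sum) (use i in auto)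
    then have "sqrt (2 * objective y z) < \<bar>y i - \<eta> i\<bar>" using i by (simp add: R_def)
    then have "sqrt (2 * objective y z) < sqrt ((y i - \<eta> i)\<^sup>2)" by simp
    then have "2 * objective y z < (y i - \<eta> i)\<^sup>2" by (simp only: real_sqrt_less_iff)
    also have "\<dots> \<le> sq_norm2 n (\<lambda>i. y i - \<eta> i)"
      unfolding sq_norm2_def by (rule member_le_sum) (use i in auto)
    also have "\<dots> \<le> 2 * objective y \<eta>"
      using mult_nonneg_nonneg[OF lam_nonneg nabla_norm1_nonneg[of E ep em \<eta>]]
      by (simp add: fused_lasso_objective_def)
    finally show ?thesis using \<theta>(2)[OF zB] by linarith
  qed (use \<theta> in auto)
  moreover have "\<theta> \<in> Rn n" using \<theta>(1) by (auto simp: Rn_def PiE_iff)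
  ultimately show ?thesis by blast
qed

lemma estimator_le: "objective y (estimator y) \<le> objective y \<eta>"
proof -
  have "\<exists>\<theta>. is_arg_min (objective y) (\<lambda>\<theta>. \<theta> \<in> Rn n) \<theta>"
    using minimizer_exists[of y] unfolding is_arg_min_linorder by blast
  then have "is_arg_min (objective y) (\<lambda>\<theta>. \<theta> \<in> Rn n) (estimator y)"
    unfolding fused_lasso_def arg_min_def by (rule someI_ex)
  then have "objective y (estimator y) \<le> objective y (restrict \<eta> {1..n})"
    by (simp only: is_arg_min_linorder Rn_def restrict_PiE_iff) simp
  then show ?thesis unfolding objective_restrict .
qed

text \<open>Comparing the minimizer with a midpoint gives strong convexity at the minimizer without any
  differentiation.\<close>

lemma estimator_strongly_minimal:
  "objective y (estimator y) + sq_norm2 n (\<lambda>i. \<eta> i - estimator y i) / 4 \<le> objective y \<eta>"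
proof -
  let ?m = "\<lambda>i. (\<eta> i + estimator y i) / 2"
  have "lam * nabla_norm1 E ep em ?m \<le> lam * ((nabla_norm1 E ep em \<eta> + nabla_norm1 E ep em (estimator y)) / 2)"
    by (intro mult_left_mono nabla_norm1_midpoint lam_nonneg)
  then have "lam * nabla_norm1 E ep em ?m \<le>
      (lam * nabla_norm1 E ep em \<eta> + lam * nabla_norm1 E ep em (estimator y)) / 2"
    by (simp only: distrib_left times_divide_eq_right)
  moreover have "objective y (estimator y) \<le> objective y ?m" by (rule estimator_le)
  ultimately show ?thesis
    unfolding fused_lasso_objective_def sq_norm2_parallelogram by argo
qed

text \<open>Each minimizer is the competitor in the other's problem. In the sum of the two
  inequalities the penalties cancel and only the pairing of the data difference with the estimator
  difference is left.\<close>

lemma estimator_Lipschitz: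
  "sq_norm2 n (\<lambda>i. estimator y i - estimator z i) \<le> 4 * sq_norm2 n (\<lambda>i. y i - z i)"
proof -
  let ?a = "estimator y" and ?b = "estimator z"
  have young: "2 * d * e \<le> 2 * d\<^sup>2 + e\<^sup>2 / 2" for d e :: real
    using zero_le_power2[of "2 * d - e"] by (simp add: power2_eq_square field_simps)
  have sym: "sq_norm2 n (\<lambda>i. ?b i - ?a i) = sq_norm2 n (\<lambda>i. ?a i - ?b i)"
    by (simp add: sq_norm2_def power2_commute)
  have "sq_norm2 n (\<lambda>i. ?a i - ?b i) \<le>
      sq_norm2 n (\<lambda>i. y i - ?b i) + sq_norm2 n (\<lambda>i. z i - ?a i) -
      sq_norm2 n (\<lambda>i. y i - ?a i) - sq_norm2 n (\<lambda>i. z i - ?b i)"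
    using estimator_strongly_minimal[of y ?b] estimator_strongly_minimal[of z ?a]
    unfolding fused_lasso_objective_def sym by linarith
  also have "\<dots> = (\<Sum>i=1..n. 2 * (y i - z i) * (?a i - ?b i))"
    unfolding sq_norm2_def sum.distrib[symmetric] sum_subtractf[symmetric]
    by (intro sum.cong) (auto simp: power2_eq_square algebra_simps)
  also have "\<dots> \<le> (\<Sum>i=1..n. 2 * (y i - z i)\<^sup>2 + (?a i - ?b i)\<^sup>2 / 2)"
    by (intro sum_mono young)
  also have "\<dots> = 2 * sq_norm2 n (\<lambda>i. y i - z i) + sq_norm2 n (\<lambda>i. ?a i - ?b i) / 2"
    by (simp add: sq_norm2_def sum.distrib sum_distrib_left sum_divide_distrib)
  finally show ?thesis by simp
qed

lemma continuous_estimator: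
  assumes i: "i \<in> {1..n}"
  shows "continuous_on UNIV (\<lambda>y. estimator y i)"
  unfolding continuous_on_def
proof (intro ballI)
  fix z :: "nat \<Rightarrow> real"
  have le: "\<bar>estimator y i - estimator z i\<bar> \<le> 2 * sqrt (sq_norm2 n (\<lambda>i. y i - z i))" for y
  proof -
    have "(estimator y i - estimator z i)\<^sup>2 \<le> sq_norm2 n (\<lambda>i. estimator y i - estimator z i)"
      unfolding sq_norm2_def by (rule member_le_sum) (use i in auto)
    also have "\<dots> \<le> 4 * sq_norm2 n (\<lambda>i. y i - z i)" by (rule estimator_Lipschitz)
    finally have "sqrt ((estimator y i - estimator z i)\<^sup>2) \<le> sqrt (4 * sq_norm2 n (\<lambda>i. y i - z i))"
      by (rule real_sqrt_le_mono)
    then show ?thesis by (simp add: real_sqrt_mult)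
  qed
  have "continuous_on UNIV (\<lambda>y. 2 * sqrt (sq_norm2 n (\<lambda>i. y i - z i)))"
    unfolding sq_norm2_def by (intro continuous_intros continuous_on_product_coordinates)
  then have "((\<lambda>y. 2 * sqrt (sq_norm2 n (\<lambda>i. y i - z i))) \<longlongrightarrow> 2 * sqrt (sq_norm2 n (\<lambda>i. z i - z i))) (at z)"
    unfolding continuous_on_def by (drule_tac bspec[of _ _ z]) (auto simp only: UNIV_I)
  then have "((\<lambda>y. 2 * sqrt (sq_norm2 n (\<lambda>i. y i - z i))) \<longlongrightarrow> 0) (at z)"
    by (simp add: sq_norm2_def)
  then have "((\<lambda>y. estimator y i - estimator z i) \<longlongrightarrow> 0) (at z)"
    by (rule Lim_null_comparison[rotated]) (use le in simp)
  then show "((\<lambda>y. estimator y i) \<longlongrightarrow> estimator z i) (at z within UNIV)"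
    by (simp add: LIM_zero_iff)
qed

lemma measurable_estimator:
  assumes i: "i \<in> {1..n}" and Y: "\<And>j. j \<in> {1..n} \<Longrightarrow> Y j \<in> borel_measurable P"
  shows "(\<lambda>\<omega>. estimator (\<lambda>j. Y j \<omega>) i) \<in> borel_measurable P"
proof -
  \<comment> \<open>Padding by 0 gives a measurable map into the whole product space; the estimator
    sees coordinates in \<open>{1..n}\<close> only.\<close>
  let ?Y = "\<lambda>\<omega> j. if j \<in> {1..n} then Y j \<omega> else 0"
  have "?Y \<in> borel_measurable P"
  proof (rule measurable_coordinatewise_then_product)
    fix j show "(\<lambda>\<omega>. ?Y \<omega> j) \<in> borel_measurable P"
      by (cases "j \<in> {1..n}") (use Y in auto)
  qed
  then have "(\<lambda>\<omega>. estimator (?Y \<omega>) i) \<in> borel_measurable P"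
    by (rule measurable_compose[OF _ borel_measurable_continuous_onI[OF continuous_estimator[OF i]]])
  moreover have "estimator (?Y \<omega>) = estimator (\<lambda>j. Y j \<omega>)" for \<omega>
    by (rule estimator_cong) simp
  ultimately show ?thesis by simp
qed

end

subsection \<open>Noise along a chain\<close>

lemma dyadic_sum_eq_sum: "dyadic_sum f k j = (\<Sum>p\<in>{j * 2^k..<j * 2^k + 2^k}. f p)"
  unfolding dyadic_sum_def sum.atLeastLessThan_shift_0[of f "j * 2^k"] by (simp add: atLeast0LessThan)

text \<open>The wavelet equals 1 / sqrt(2^(k+1)) up to sign on 2^(k+1) points; this form feeds the
  moment bounds for linear combinations.\<close>

lemma haar_linear:
  obtains c B where "finite B" "\<And>f. haar f k j = (\<Sum>p\<in>B. c p * f p)" "(\<Sum>p\<in>B. (c p)\<^sup>2) \<le> 1"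
proof -
  define B1 where "B1 = {2 * j * 2^k..<2 * j * 2^k + 2^k}"
  define B2 where "B2 = {(2 * j + 1) * 2^k..<(2 * j + 1) * 2^k + 2^k}"
  define c where "c p = (if p \<in> B1 then 1 else - 1) / sqrt (2 ^ Suc k)" for p
  have disj: "B1 \<inter> B2 = {}" by (auto simp: B1_def B2_def)
  show thesis
  proof
    show "finite (B1 \<union> B2)" by (simp add: B1_def B2_def)
    show "haar f k j = (\<Sum>p\<in>B1 \<union> B2. c p * f p)" for f
    proof -
      have "(\<Sum>p\<in>B1 \<union> B2. c p * f p) = (\<Sum>p\<in>B1. c p * f p) + (\<Sum>p\<in>B2. c p * f p)"
        by (rule sum.union_disjoint) (use disj in \<open>auto simp: B1_def B2_def\<close>)
      also have "(\<Sum>p\<in>B1. c p * f p) = sum f B1 / sqrt (2 ^ Suc k)"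
        unfolding sum_divide_distrib by (intro sum.cong) (auto simp: c_def)
      also have "(\<Sum>p\<in>B2. c p * f p) = - sum f B2 / sqrt (2 ^ Suc k)"
        unfolding sum_divide_distrib sum_negf[symmetric]
        by (intro sum.cong) (use disj in \<open>auto simp: c_def\<close>)
      finally show ?thesis
        unfolding haar_def dyadic_sum_eq_sum B1_def B2_def by (simp add: diff_divide_distrib)
    qed
    have sq: "(c p)\<^sup>2 = 1 / 2 ^ Suc k" for p by (simp add: c_def power_divide)
    have "card (B1 \<union> B2) = 2 ^ Suc k"
      using disj by (subst card_Un_disjoint) (auto simp: B1_def B2_def)
    then show "(\<Sum>p\<in>B1 \<union> B2. (c p)\<^sup>2) \<le> 1" unfolding sq by simp
  qed
qed

text \<open>Positions past the end carry no noise, so the values given to the signal there do not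
  affect the pairing.\<close>

definition along_chain :: "'v list \<Rightarrow> ('v \<Rightarrow> real) \<Rightarrow> nat \<Rightarrow> real" where
  "along_chain xs e p = (if p < length xs then e (xs ! p) else 0)"

text \<open>Moves coefficients from positions to vertices; dropping positions past the end only
  lowers the sum of squares.\<close>

lemma sum_along_chain:
  assumes "distinct xs" and "finite B" and c: "(\<Sum>p\<in>B. (c p)\<^sup>2) \<le> 1"
  obtains J d where "J \<subseteq> set xs" "(\<Sum>i\<in>J. (d i)\<^sup>2) \<le> 1"
    "\<And>e. (\<Sum>p\<in>B. c p * along_chain xs e p) = (\<Sum>i\<in>J. d i * e i)"
proof -
  define B' where "B' = B \<inter> {..<length xs}"
  define d where "d = (\<lambda>i. c (the_inv_into {..<length xs} ((!) xs) i))"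
  have inj: "inj_on ((!) xs) {..<length xs}" using assms(1) by (auto simp: inj_on_def nth_eq_iff_index_eq)
  then have inj': "inj_on ((!) xs) B'" by (rule inj_on_subset) (simp add: B'_def)
  have d: "d (xs ! p) = c p" if "p \<in> B'" for p
    using that inj by (simp add: d_def B'_def the_inv_into_f_f)
  show thesis
  proof
    show "(!) xs ` B' \<subseteq> set xs" by (auto simp: B'_def)
    have "(\<Sum>i\<in>(!) xs ` B'. (d i)\<^sup>2) = (\<Sum>p\<in>B'. (c p)\<^sup>2)"
      by (simp add: sum.reindex[OF inj'] d)
    also have "\<dots> \<le> (\<Sum>p\<in>B. (c p)\<^sup>2)"
      by (rule sum_mono2) (use assms(2) in \<open>auto simp: B'_def\<close>)
    finally show "(\<Sum>i\<in>(!) xs ` B'. (d i)\<^sup>2) \<le> 1" using c by linarith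
    show "(\<Sum>p\<in>B. c p * along_chain xs e p) = (\<Sum>i\<in>(!) xs ` B'. d i * e i)" for e
    proof -
      have "(\<Sum>p\<in>B. c p * along_chain xs e p) = (\<Sum>p\<in>B'. c p * e (xs ! p))"
        by (rule sum.mono_neutral_cong_right) (use assms(2) in \<open>auto simp: B'_def along_chain_def\<close>)
      also have "\<dots> = (\<Sum>i\<in>(!) xs ` B'. d i * e i)"
        by (simp add: sum.reindex[OF inj'] d)
      finally show ?thesis .
    qed
  qed
qed

text \<open>The factor 1 / 2^(k+1) is the share of level \<open>k\<close> among 2^m coefficients.
  Below \<open>l\<close> the weights decay faster than the shares grow, and from \<open>l\<close> on
  the shares themselves are summable.\<close>

lemma sum_excess_weights_le:
  "(\<Sum>k<m. 1 / 2 ^ Suc k * (if k < l then 1 / qrt2 ^ (6 * (l - k)) else 1)) \<le> 3 / (2 ^ l :: real)"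
proof -
  have q0: "qrt2 > 0" using qrt2_ge by simp
  have "qrt2 ^ 6 \<ge> (7/6) ^ 6" by (intro power_mono qrt2_ge) simp
  moreover have "(5/2 :: real) \<le> (7/6) ^ 6" by (simp add: power_divide)
  \<comment> \<open>5/2 closes the induction exactly: (2 + 1/2) / (5/2) = 1.\<close>
  ultimately have q6: "qrt2 ^ 6 \<ge> 5/2" by linarith
  have fine: "(\<Sum>k<l. 1 / 2 ^ Suc k * (1 / qrt2 ^ (6 * (l - k)))) \<le> 2 / (2 ^ l :: real)" for l
  proof (induction l)
    case (Suc l)
    define S where "S = (\<Sum>k<l. 1 / 2 ^ Suc k * (1 / qrt2 ^ (6 * (l - k))))"
    have "(\<Sum>k<l. 1 / 2 ^ Suc k * (1 / qrt2 ^ (6 * (Suc l - k)))) = S / qrt2 ^ 6"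
      unfolding S_def sum_divide_distrib by (intro sum.cong) (auto simp: Suc_diff_le power_add mult_ac)
    then have "(\<Sum>k<Suc l. 1 / 2 ^ Suc k * (1 / qrt2 ^ (6 * (Suc l - k)))) =
        (S + 1 / 2 ^ Suc l) / qrt2 ^ 6"
      by (simp add: add_divide_distrib)
    also have "\<dots> \<le> (2 / 2 ^ l + 1 / 2 ^ Suc l) / qrt2 ^ 6"
      using Suc q0 by (intro divide_right_mono) (auto simp: S_def)
    also have "\<dots> \<le> (2 / 2 ^ l + 1 / 2 ^ Suc l) / (5/2)"
      using q6 q0 by (intro divide_left_mono) auto
    also have "\<dots> = 2 / 2 ^ Suc l" by (simp add: field_simps)
    finally show ?case .
  qed simp
  have coarse: "(\<Sum>k\<in>{l..<m}. 1 / 2 ^ Suc k) \<le> 1 / (2 ^ l :: real)" for l m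
  proof (cases "l \<le> m")
    case True
    then have "(\<Sum>k\<in>{l..<m}. 1 / 2 ^ Suc k) = 1 / (2 ^ l :: real) - 1 / 2 ^ m"
    proof (induction m rule: dec_induct)
      case (step m)
      then show ?case by (simp only: sum.atLeastLessThan_Suc) (simp add: field_simps)
    qed simp
    then show ?thesis by simp
  qed simp
  have "(\<Sum>k<m. 1 / 2 ^ Suc k * (if k < l then 1 / qrt2 ^ (6 * (l - k)) else 1)) \<le>
      (\<Sum>k\<in>{..<l} \<union> {l..<m}. 1 / 2 ^ Suc k * (if k < l then 1 / qrt2 ^ (6 * (l - k)) else 1))"
    by (rule sum_mono2) (use q0 in auto)
  also have "\<dots> = (\<Sum>k<l. 1 / 2 ^ Suc k * (1 / qrt2 ^ (6 * (l - k)))) + (\<Sum>k\<in>{l..<m}. 1 / 2 ^ Suc k)"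
    by (subst sum.union_disjoint) auto
  also have "\<dots> \<le> 3 / 2 ^ l" using fine[of l] coarse[of l m] by simp
  finally show ?thesis .
qed

section \<open>Expected excess of the noise\<close>

context sub_Gaussian_family
begin

lemma moments_along_chain:
  assumes "distinct xs" "set xs = I" and "finite B" "(\<Sum>p\<in>B. (c p)\<^sup>2) \<le> 1"
    and Z: "\<And>f. Z f = (\<Sum>p\<in>B. c p * f p)"
  shows "integrable P (\<lambda>\<omega>. Z (along_chain xs (\<lambda>i. X i \<omega>)) ^ 8)"
    "(\<integral>\<omega>. Z (along_chain xs (\<lambda>i. X i \<omega>)) ^ 8 \<partial>P) \<le> eighth_moment_bound K s"
    "integrable P (\<lambda>\<omega>. (Z (along_chain xs (\<lambda>i. X i \<omega>)))\<^sup>2)"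
    "(\<integral>\<omega>. (Z (along_chain xs (\<lambda>i. X i \<omega>)))\<^sup>2 \<partial>P) \<le> 1 + eighth_moment_bound K s"
proof -
  obtain J d where J: "J \<subseteq> I" and d: "(\<Sum>i\<in>J. (d i)\<^sup>2) \<le> 1"
    and eq: "\<And>e. (\<Sum>p\<in>B. c p * along_chain xs e p) = (\<Sum>i\<in>J. d i * e i)"
    using sum_along_chain[OF assms(1,3,4)] assms(2) by metis
  note all = eighth_moment_linear[OF J d] second_moment_linear[OF J d]
  show "integrable P (\<lambda>\<omega>. Z (along_chain xs (\<lambda>i. X i \<omega>)) ^ 8)"
    "(\<integral>\<omega>. Z (along_chain xs (\<lambda>i. X i \<omega>)) ^ 8 \<partial>P) \<le> eighth_moment_bound K s"
    "integrable P (\<lambda>\<omega>. (Z (along_chain xs (\<lambda>i. X i \<omega>)))\<^sup>2)"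
    "(\<integral>\<omega>. (Z (along_chain xs (\<lambda>i. X i \<omega>)))\<^sup>2 \<partial>P) \<le> 1 + eighth_moment_bound K s"
    unfolding Z eq by (fact all)+
qed

text \<open>The summand 1 is the contribution of the mean, the fraction that of the weighted
  levels.\<close>

lemma expectation_haar_excess:
  assumes xs: "distinct xs" "set xs = I"
  shows "integrable P (\<lambda>\<omega>. haar_excess m l (along_chain xs (\<lambda>i. X i \<omega>)))"
    and "(\<integral>\<omega>. haar_excess m l (along_chain xs (\<lambda>i. X i \<omega>)) \<partial>P) \<le>
      (1 + eighth_moment_bound K s) * (1 + 3 * 2 ^ m / 2 ^ l)"
proof -
  define M where "M = 1 + eighth_moment_bound K s"
  have M: "M \<ge> 0" using eighth_moment_bound_nonneg by (simp add: M_def)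
  define f where "f \<omega> = along_chain xs (\<lambda>i. X i \<omega>)" for \<omega>
  define h where "h k j \<omega> = (if k < l then haar (f \<omega>) k j ^ 8 / qrt2 ^ (6 * (l - k)) else (haar (f \<omega>) k j)\<^sup>2)"
    for k j \<omega>
  define w where "w k = (if k < l then 1 / qrt2 ^ (6 * (l - k)) else 1)" for k
  have h: "integrable P (h k j)" "(\<integral>\<omega>. h k j \<omega> \<partial>P) \<le> w k * M" for k j
  proof -
    obtain c B where "finite B" "\<And>f. haar f k j = (\<Sum>p\<in>B. c p * f p)" "(\<Sum>p\<in>B. (c p)\<^sup>2) \<le> 1"
      using haar_linear by metis
    then have mom: "integrable P (\<lambda>\<omega>. haar (f \<omega>) k j ^ 8)"
      "(\<integral>\<omega>. haar (f \<omega>) k j ^ 8 \<partial>P) \<le> M"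
      "integrable P (\<lambda>\<omega>. (haar (f \<omega>) k j)\<^sup>2)" "(\<integral>\<omega>. (haar (f \<omega>) k j)\<^sup>2 \<partial>P) \<le> M"
      using moments_along_chain[OF xs, of B c "\<lambda>f. haar f k j"] by (auto simp: f_def M_def)
    show "integrable P (h k j)" unfolding h_def using mom by (cases "k < l") auto
    show "(\<integral>\<omega>. h k j \<omega> \<partial>P) \<le> w k * M"
      unfolding h_def w_def using mom qrt2_ge by (cases "k < l") (auto intro!: divide_right_mono)
  qed
  have mean: "integrable P (\<lambda>\<omega>. (dyadic_sum (f \<omega>) m 0 / sqrt (2 ^ m))\<^sup>2)"
    "(\<integral>\<omega>. (dyadic_sum (f \<omega>) m 0 / sqrt (2 ^ m))\<^sup>2 \<partial>P) \<le> M"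
    using moments_along_chain(3,4)[OF xs, of "{..<2^m}" "\<lambda>_. 1 / sqrt (2 ^ m)" "\<lambda>f. dyadic_sum f m 0 / sqrt (2 ^ m)"]
    by (auto simp: f_def M_def dyadic_sum_def sum_divide_distrib power_divide)
  have ex: "haar_excess m l (f \<omega>) =
      (dyadic_sum (f \<omega>) m 0 / sqrt (2 ^ m))\<^sup>2 + (\<Sum>k<m. \<Sum>j<2^(m - Suc k). h k j \<omega>)" for \<omega>
    by (simp add: haar_excess_def h_def)
  show "integrable P (\<lambda>\<omega>. haar_excess m l (along_chain xs (\<lambda>i. X i \<omega>)))"
    unfolding f_def[symmetric] ex using mean h by auto
  have "(\<integral>\<omega>. haar_excess m l (f \<omega>) \<partial>P) =
      (\<integral>\<omega>. (dyadic_sum (f \<omega>) m 0 / sqrt (2 ^ m))\<^sup>2 \<partial>P) +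
      (\<Sum>k<m. \<Sum>j<2^(m - Suc k). \<integral>\<omega>. h k j \<omega> \<partial>P)"
    unfolding ex using mean h by (subst Bochner_Integration.integral_add) auto
  also have "\<dots> \<le> M + (\<Sum>k<m. \<Sum>j<(2::nat)^(m - Suc k). w k * M)"
    by (intro add_mono sum_mono mean h)
  also have "(\<Sum>k<m. \<Sum>j<(2::nat)^(m - Suc k). w k * M) = M * 2 ^ m * (\<Sum>k<m. 1 / 2 ^ Suc k * w k)"
    unfolding sum_distrib_left
  proof (rule sum.cong)
    fix k assume "k \<in> {..<m}"
    then have "(2::real) ^ m = 2 ^ (m - Suc k) * 2 ^ Suc k" by (simp flip: power_add power_Suc)
    then show "(\<Sum>j<(2::nat)^(m - Suc k). w k * M) = M * 2 ^ m * (1 / 2 ^ Suc k * w k)" by simp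
  qed simp
  also have "\<dots> \<le> M * 2 ^ m * (3 / 2 ^ l)"
    unfolding w_def using M by (intro mult_left_mono sum_excess_weights_le) auto
  finally show "(\<integral>\<omega>. haar_excess m l (along_chain xs (\<lambda>i. X i \<omega>)) \<partial>P) \<le>
      (1 + eighth_moment_bound K s) * (1 + 3 * 2 ^ m / 2 ^ l)"
    by (simp add: f_def M_def algebra_simps add_divide_distrib)
qed

end

text \<open>The chain is traversed forwards and then backwards to reach a length that is a power of two:
  unlike an extension by constants, this only doubles both the squared norm and the variation.\<close>

lemma inner_product_le_chain_variation:
  assumes xs: "distinct xs" "xs \<noteq> []" and m: "length xs \<le> 2 ^ m" "2 ^ m \<le> 2 * length xs"
  shows "(\<Sum>i\<in>set xs. e i * \<theta> i) \<le> (\<Sum>i\<in>set xs. (\<theta> i)\<^sup>2) / 4 +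
    12 * (sqrt (2 ^ l) - 1) * chain_variation \<theta> xs + 2 * haar_excess m l (along_chain xs e)"
proof -
  define n where "n = length xs"
  have n: "n > 0" using xs by (simp add: n_def)
  \<comment> \<open>At \<open>p = 2 * n\<close> truncated subtraction yields index 0 once more, so
    the increment past the end is zero, as is the one at the turning point.\<close>
  define g where "g p = \<theta> (xs ! (if p < n then p else 2 * n - 1 - p))" for p
  define f where "f = along_chain xs e"
  have reidx: "(\<Sum>i\<in>set xs. h i) = (\<Sum>p<n. h (xs ! p))" for h :: "'a \<Rightarrow> real"
    using sum.reindex_bij_betw[OF bij_betw_nth[OF xs(1) refl refl], of h] by (simp add: n_def)
  have split: "(\<Sum>p<2 * n. h p) = (\<Sum>p<n. h p) + (\<Sum>p<n. h (2 * n - 1 - p))" for h :: "nat \<Rightarrow> real"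
  proof -
    have "(\<Sum>p<2 * n. h p) = (\<Sum>p<n. h p) + (\<Sum>p\<in>{n..<2 * n}. h p)"
      by (subst sum.union_disjoint[symmetric]) (auto intro!: sum.cong)
    also have "(\<Sum>p\<in>{n..<2 * n}. h p) = (\<Sum>p<n. h (2 * n - 1 - p))"
      by (rule sum.reindex_bij_witness[of _ "\<lambda>p. 2 * n - 1 - p" "\<lambda>p. 2 * n - 1 - p"]) auto
    finally show ?thesis .
  qed
  have "(\<Sum>i\<in>set xs. e i * \<theta> i) = (\<Sum>p<n. f p * g p)"
    unfolding reidx by (intro sum.cong) (auto simp: f_def g_def along_chain_def n_def)
  also have "\<dots> = (\<Sum>p<2^m. f p * g p)"
    by (rule sum.mono_neutral_left) (use m in \<open>auto simp: f_def along_chain_def n_def\<close>)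
  finally have inner: "(\<Sum>i\<in>set xs. e i * \<theta> i) = (\<Sum>p<2^m. f p * g p)" .
  have main: "(\<Sum>p<2^m. f p * g p) \<le> (\<Sum>p<2^m. (g p)\<^sup>2) / 8 +
     6 * (sqrt (2 ^ l) - 1) * (\<Sum>p<2^m. \<bar>g (Suc p) - g p\<bar>) + 2 * haar_excess m l f"
    by (rule sum_mult_le_variation_plus_excess)
  \<comment> \<open>The dyadic window may cut the way back anywhere; nonnegative sums are extended
    to the full round trip.\<close>
  have "(\<Sum>p<2^m. (g p)\<^sup>2) \<le> (\<Sum>p<2 * n. (g p)\<^sup>2)"
    by (rule sum_mono2) (use m in \<open>auto simp: n_def\<close>)
  also have "(\<Sum>p<2 * n. (g p)\<^sup>2) = 2 * (\<Sum>i\<in>set xs. (\<theta> i)\<^sup>2)"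
  proof -
    have "g (2 * n - 1 - p) = \<theta> (xs ! p)" "g p = \<theta> (xs ! p)" if "p < n" for p
      using that by (auto simp: g_def)
    then show ?thesis unfolding split reidx by simp
  qed
  finally have sq: "(\<Sum>p<2^m. (g p)\<^sup>2) \<le> 2 * (\<Sum>i\<in>set xs. (\<theta> i)\<^sup>2)" .
  have "(\<Sum>p<2^m. \<bar>g (Suc p) - g p\<bar>) \<le> (\<Sum>p<2 * n. \<bar>g (Suc p) - g p\<bar>)"
    by (rule sum_mono2) (use m in \<open>auto simp: n_def\<close>)
  also have "(\<Sum>p<2 * n. \<bar>g (Suc p) - g p\<bar>) = 2 * chain_variation \<theta> xs"
  proof -
    obtain r where r: "n = Suc r" using n by (cases n) auto
    have "(\<Sum>p<n. \<bar>g (Suc p) - g p\<bar>) = (\<Sum>p<r. \<bar>\<theta> (xs ! Suc p) - \<theta> (xs ! p)\<bar>)"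
      unfolding r sum.lessThan_Suc using r by (simp add: g_def)
    moreover have "(\<Sum>p<n. \<bar>g (Suc (2 * n - 1 - p)) - g (2 * n - 1 - p)\<bar>) =
        (\<Sum>p<r. \<bar>\<theta> (xs ! Suc p) - \<theta> (xs ! p)\<bar>)"
    proof -
      have "(\<Sum>p<n. \<bar>g (Suc (2 * n - 1 - p)) - g (2 * n - 1 - p)\<bar>) =
          (\<Sum>p<r. \<bar>g (Suc (2 * n - 1 - Suc p)) - g (2 * n - 1 - Suc p)\<bar>)"
        unfolding r sum.lessThan_Suc_shift using r by (simp add: g_def)
      also have "\<dots> = (\<Sum>p<r. \<bar>\<theta> (xs ! Suc p) - \<theta> (xs ! p)\<bar>)"
      proof (rule sum.cong)
        fix p assume "p \<in> {..<r}"
        then have p: "p < r" by simp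
        have "g (Suc (2 * n - 1 - Suc p)) = \<theta> (xs ! p)" "g (2 * n - 1 - Suc p) = \<theta> (xs ! Suc p)"
          using p r by (auto simp: g_def intro!: arg_cong[where f = "\<lambda>i. \<theta> (xs ! i)"])
        then show "\<bar>g (Suc (2 * n - 1 - Suc p)) - g (2 * n - 1 - Suc p)\<bar> = \<bar>\<theta> (xs ! Suc p) - \<theta> (xs ! p)\<bar>"
          by (simp add: abs_minus_commute)
      qed simp
      finally show ?thesis .
    qed
    ultimately show ?thesis
      unfolding split chain_variation_conv_sum using r by (simp add: n_def)
  qed
  finally have "6 * (sqrt (2 ^ l) - 1) * (\<Sum>p<2^m. \<bar>g (Suc p) - g p\<bar>) \<le>
      6 * (sqrt (2 ^ l) - 1) * (2 * chain_variation \<theta> xs)"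
    by (rule mult_left_mono) simp
  also have "\<dots> = 12 * (sqrt (2 ^ l) - 1) * chain_variation \<theta> xs" by simp
  finally show ?thesis using inner main sq unfolding f_def by linarith
qed

subsection \<open>Estimation error\<close>

lemma power_two_between:
  fixes n :: nat
  assumes "n \<ge> 1"
  shows "\<exists>m. n \<le> 2 ^ m \<and> 2 ^ m \<le> 2 * n"
  using assms
proof (induction n rule: dec_induct)
  case base
  show ?case by (intro exI[of _ 0]) simp
next
  case (step n)
  then obtain m where m: "n \<le> 2 ^ m" "2 ^ m \<le> 2 * n" by blast
  show ?case
  proof (cases "n = 2 ^ m")
    case True
    then show ?thesis using step.hyps by (intro exI[of _ "Suc m"]) simp
  next
    case False
    then show ?thesis using m by (intro exI[of _ m]) simp
  qed
qed

context fused_lasso_problem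
begin

text \<open>The factor 24 is 6 * 2 * 2: the threshold sum, the reflection, and the ordering of the
  vertices. The penalty of the estimator cancels, and a quarter of the squared error remains on the
  left, hence the factors 8.\<close>

lemma estimation_error_le:
  assumes xs: "distinct xs" "set xs = {1..n}" "n \<ge> 1"
    and chain: "\<And>\<theta>. chain_variation \<theta> xs \<le> 2 * nabla_norm1 E ep em \<theta>"
    and m: "n \<le> 2 ^ m" "2 ^ m \<le> 2 * n"
    and l: "24 * (sqrt (2 ^ l) - 1) \<le> lam"
    and \<theta>: "nabla_norm1 E ep em \<theta> \<le> t"
    and y: "\<And>i. i \<in> {1..n} \<Longrightarrow> y i = \<theta> i + e i"
  shows "sq_norm2 n (\<lambda>i. estimator y i - \<theta> i) \<le>
    8 * haar_excess m l (along_chain xs e) + 8 * (lam * t)"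
proof -
  define \<Delta> where "\<Delta> i = estimator y i - \<theta> i" for i
  define N where "N = nabla_norm1 E ep em"
  have len: "length xs = n" using xs distinct_card by fastforce
  have nonempty: "xs \<noteq> []" using xs(2,3) by auto
  have N0: "N \<eta> \<ge> 0" for \<eta> unfolding N_def by (rule nabla_norm1_nonneg)
  have l0: "0 \<le> 12 * (sqrt (2 ^ l) - 1)" by simp
  have "sq_norm2 n (\<lambda>i. y i - estimator y i) / 2 + lam * N (estimator y) \<le>
      sq_norm2 n (\<lambda>i. y i - \<theta> i) / 2 + lam * N \<theta>"
    using estimator_le[of y \<theta>] by (simp add: fused_lasso_objective_def N_def)
  moreover have "sq_norm2 n (\<lambda>i. y i - \<theta> i) - sq_norm2 n (\<lambda>i. y i - estimator y i) =
      2 * (\<Sum>i\<in>{1..n}. e i * \<Delta> i) - sq_norm2 n \<Delta>"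
    unfolding sq_norm2_def sum_subtractf[symmetric] sum_distrib_left
    by (intro sum.cong) (auto simp: y \<Delta>_def power2_eq_square algebra_simps)
  ultimately have basic: "sq_norm2 n \<Delta> / 2 \<le> (\<Sum>i\<in>{1..n}. e i * \<Delta> i) + lam * N \<theta> - lam * N (estimator y)"
    by argo
  have "(\<Sum>i\<in>{1..n}. e i * \<Delta> i) \<le> sq_norm2 n \<Delta> / 4 +
      12 * (sqrt (2 ^ l) - 1) * chain_variation \<Delta> xs + 2 * haar_excess m l (along_chain xs e)"
    using inner_product_le_chain_variation[of xs m e \<Delta> l] xs m len nonempty
    by (auto simp: sq_norm2_def)
  also have "12 * (sqrt (2 ^ l) - 1) * chain_variation \<Delta> xs \<le> 12 * (sqrt (2 ^ l) - 1) * (2 * N \<Delta>)"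
    unfolding N_def by (intro mult_left_mono chain l0)
  also have "\<dots> = 24 * (sqrt (2 ^ l) - 1) * N \<Delta>" by simp
  also have "\<dots> \<le> lam * N \<Delta>" by (intro mult_right_mono l N0)
  also have "\<dots> \<le> lam * (N (estimator y) + N \<theta>)"
    unfolding N_def \<Delta>_def by (intro mult_left_mono nabla_norm1_triangle lam_nonneg)
  finally have "(\<Sum>i\<in>{1..n}. e i * \<Delta> i) \<le> sq_norm2 n \<Delta> / 4 +
      (lam * N (estimator y) + lam * N \<theta>) + 2 * haar_excess m l (along_chain xs e)"
    by (simp add: distrib_left)
  moreover have "lam * N \<theta> \<le> lam * t" unfolding N_def by (intro mult_left_mono \<theta> lam_nonneg)
  ultimately have "sq_norm2 n \<Delta> \<le> 8 * haar_excess m l (along_chain xs e) + 8 * (lam * t)"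
    using basic by argo
  then show ?thesis by (simp add: \<Delta>_def[abs_def])
qed

text \<open>Markov's inequality for the excess, with a real parameter \<open>L\<close> in place of
  the power 2^l.\<close>

lemma estimation_error_tail:
  assumes G: "connected_graph {1..n} E" and n: "n \<ge> 1"
    and fam: "sub_Gaussian_family P e {1..n} K s"
    and L: "L > 0" "24 * sqrt (2 * L) \<le> lam"
    and \<theta>: "nabla_norm1 E ep em \<theta> \<le> t"
    and y: "\<And>i \<omega>. i \<in> {1..n} \<Longrightarrow> \<omega> \<in> space P \<Longrightarrow> y i \<omega> = \<theta> i + e i \<omega>"
    and u: "u > 0"
  shows "measure P {\<omega> \<in> space P. sq_norm2 n (\<lambda>i. estimator (\<lambda>j. y j \<omega>) i - \<theta> i) > 8 * u + 8 * (lam * t)}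
    \<le> (1 + eighth_moment_bound K s) * (1 + 6 * real n / L) / u"
proof -
  interpret sub_Gaussian_family P e "{1..n}" K s by (rule fam)
  obtain xs where chain_order: "distinct xs \<and> set xs = {1..n} \<and>
      (\<forall>\<theta>. chain_variation \<theta> xs \<le> 2 * nabla_norm1 E ep em \<theta>)"
    using connected_graph_chain[OF G orient] by (rule exE)
  then have xs: "distinct xs" "set xs = {1..n}" by blast+
  have chain: "chain_variation \<theta> xs \<le> 2 * nabla_norm1 E ep em \<theta>" for \<theta>
    using chain_order[THEN conjunct2, THEN conjunct2] by (rule spec)
  obtain m where m: "n \<le> 2 ^ m" "2 ^ m \<le> 2 * n"
    using power_two_between[OF n] by blast
  \<comment> \<open>The least such \<open>l\<close> overshoots \<open>L\<close> by a factor of at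
    most 2 unless \<open>l = 0\<close>, and then the \<open>- 1\<close> makes the left side zero;
    this includes \<open>L < 1\<close>, that is, small \<open>lam\<close>.\<close>
  obtain l where l: "L \<le> 2 ^ l" "sqrt (2 ^ l) - 1 \<le> sqrt (2 * L)"
  proof -
    define l where "l = (LEAST l. L \<le> 2 ^ l)"
    obtain l0 where "L < 2 ^ l0" using real_arch_pow[of 2 L] by auto
    then have "L \<le> 2 ^ l0" by simp
    then have 1: "L \<le> 2 ^ l" unfolding l_def by (rule LeastI)
    have "sqrt (2 ^ l) - 1 \<le> sqrt (2 * L)"
    proof (cases l)
      case 0
      then show ?thesis using L by simp
    next
      case (Suc j)
      then have "j < (LEAST l. L \<le> 2 ^ l)" unfolding l_def by linarith
      then have "\<not> L \<le> 2 ^ j" by (rule not_less_Least)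
      then have "sqrt (2 ^ l) \<le> sqrt (2 * L)" using Suc by simp
      then show ?thesis by linarith
    qed
    with 1 show thesis using that by blast
  qed
  have "24 * (sqrt (2 ^ l) - 1) \<le> 24 * sqrt (2 * L)" using l(2) by (rule mult_left_mono) simp
  then have level: "24 * (sqrt (2 ^ l) - 1) \<le> lam" using L(2) by (rule order_trans)
  define W where "W \<omega> = haar_excess m l (along_chain xs (\<lambda>i. e i \<omega>))" for \<omega>
  have W: "integrable P W" using expectation_haar_excess(1)[OF xs] by (simp add: W_def[abs_def])
  have W0: "W \<omega> \<ge> 0" for \<omega>
    unfolding W_def haar_excess_def using qrt2_ge by (intro add_nonneg_nonneg sum_nonneg) auto
  have "(\<integral>\<omega>. W \<omega> \<partial>P) \<le> (1 + eighth_moment_bound K s) * (1 + 3 * 2 ^ m / 2 ^ l)"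
    using expectation_haar_excess(2)[OF xs] by (simp add: W_def)
  also have "\<dots> \<le> (1 + eighth_moment_bound K s) * (1 + 6 * real n / L)"
  proof (intro mult_left_mono add_left_mono frac_le)
    have "real (2 ^ m) \<le> real (2 * n)" using m(2) by (rule of_nat_mono)
    then show "3 * 2 ^ m \<le> 6 * real n" by simp
  qed (use L l eighth_moment_bound_nonneg in auto)
  finally have EW: "(\<integral>\<omega>. W \<omega> \<partial>P) \<le> (1 + eighth_moment_bound K s) * (1 + 6 * real n / L)" .
  have [measurable]: "W \<in> borel_measurable P" using W by auto
  have "measure P {\<omega> \<in> space P. sq_norm2 n (\<lambda>i. estimator (\<lambda>j. y j \<omega>) i - \<theta> i) > 8 * u + 8 * (lam * t)} \<le>
      measure P {\<omega> \<in> space P. W \<omega> \<ge> u}"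
  proof (rule finite_measure_mono)
    show "{\<omega> \<in> space P. sq_norm2 n (\<lambda>i. estimator (\<lambda>j. y j \<omega>) i - \<theta> i) > 8 * u + 8 * (lam * t)} \<subseteq>
        {\<omega> \<in> space P. W \<omega> \<ge> u}"
    proof safe
      fix \<omega> assume \<omega>: "\<omega> \<in> space P"
        and big: "8 * u + 8 * (lam * t) < sq_norm2 n (\<lambda>i. estimator (\<lambda>j. y j \<omega>) i - \<theta> i)"
      have "sq_norm2 n (\<lambda>i. estimator (\<lambda>j. y j \<omega>) i - \<theta> i) \<le> 8 * W \<omega> + 8 * (lam * t)"
        unfolding W_def
        by (rule estimation_error_le[OF xs n chain m level \<theta> y[OF _ \<omega>]])
      with big show "u \<le> W \<omega>" by linarith
    qed
  qed measurable
  also have "\<dots> \<le> (\<integral>\<omega>. W \<omega> \<partial>P) / u"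
    by (rule integral_Markov_inequality_measure[OF W, of "{}"]) (use W0 u in auto)
  also have "\<dots> \<le> (1 + eighth_moment_bound K s) * (1 + 6 * real n / L) / u"
    using EW u by (intro divide_right_mono) auto
  finally show ?thesis .
qed

end

theorem theorem3:
  fixes P :: "nat \<Rightarrow> 'a measure"
    and E :: "nat \<Rightarrow> nat set set"
    and ep em :: "nat \<Rightarrow> nat set \<Rightarrow> nat"
    and \<epsilon> y :: "nat \<Rightarrow> nat \<Rightarrow> 'a \<Rightarrow> real"
    and \<theta>\<^sub>0 :: "nat \<Rightarrow> nat \<Rightarrow> real"
    and t lam :: "nat \<Rightarrow> real"
    and K \<sigma> :: real
  assumes prob: "\<And>n. n \<ge> 1 \<Longrightarrow> prob_space (P n)"
    and graph: "\<And>n. n \<ge> 1 \<Longrightarrow> connected_graph {1..n} (E n)"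
    and orient: "\<And>n. n \<ge> 1 \<Longrightarrow> edge_orientation (E n) (ep n) (em n)"
    and const_pos: "K > 0" "\<sigma> > 0"
    and indep: "\<And>n. n \<ge> 1 \<Longrightarrow> prob_space.indep_vars (P n) (\<lambda>_. borel) (\<epsilon> n) {1..n}"
    and ident: "\<And>n i j. n \<ge> 1 \<Longrightarrow> i \<in> {1..n} \<Longrightarrow> j \<in> {1..n} \<Longrightarrow>
                  distr (P n) borel (\<epsilon> n i) = distr (P n) borel (\<epsilon> n j)"
    and subgauss: "\<And>n i. n \<ge> 1 \<Longrightarrow> i \<in> {1..n} \<Longrightarrow> sub_Gaussian (P n) (\<epsilon> n i) K \<sigma>"
    and t_pos: "\<And>n. n \<ge> 1 \<Longrightarrow> t n > 0"
    and t_lower: "(\<lambda>n. 1 / t n) \<in> O(\<lambda>n. sqrt (real n))"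
    and theta0: "\<And>n. n \<ge> 1 \<Longrightarrow> \<theta>\<^sub>0 n \<in> BV n (E n) (ep n) (em n) (t n)"
    and model: "\<And>n i \<omega>. n \<ge> 1 \<Longrightarrow> i \<in> {1..n} \<Longrightarrow> \<omega> \<in> space (P n) \<Longrightarrow>
                  y n i \<omega> = \<theta>\<^sub>0 n i + \<epsilon> n i \<omega>"
    and lambda_nonneg: "\<And>n. n \<ge> 1 \<Longrightarrow> lam n \<ge> 0"
    and lambda_rate: "lam \<in> \<Theta>(\<lambda>n. t n powr (-1/3) * real n powr (1/3))"
  shows "bigo_prob P
           (\<lambda>n \<omega>. sq_norm_n n
              (\<lambda>i. fused_lasso n (E n) (ep n) (em n) (lam n) (\<lambda>j. y n j \<omega>) i - \<theta>\<^sub>0 n i))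
           (\<lambda>n. t n powr (2/3) * real n powr (-2/3))"
proof -
  define R where "R n = t n powr (-1/3) * real n powr (1/3)" for n
  \<comment> \<open>\<open>a n\<close> is \<open>n\<close> times the claimed rate. The identities R
    t = a and n / R^2 = a below put penalty and noise at the same order.\<close>
  define a where "a n = t n powr (2/3) * real n powr (1/3)" for n
  have problem: "fused_lasso_problem n (E n) (ep n) (em n) (lam n)" if "n \<ge> 1" for n
    by (rule fused_lasso_problem.intro)
       (use graph[OF that] orient[OF that] lambda_nonneg[OF that] in \<open>simp_all add: connected_graph_def\<close>)
  have fam: "sub_Gaussian_family (P n) (\<epsilon> n) {1..n} K \<sigma>" if "n \<ge> 1" for n
    by (intro sub_Gaussian_family.intro sub_Gaussian_family_axioms.intro prob[OF that] indep[OF that]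
        subgauss[OF that] const_pos) auto
  have R: "R n > 0" "a n > 0" "R n * t n = a n" "real n = a n * (R n)\<^sup>2"
    "a n = real n * (t n powr (2/3) * real n powr (-2/3))" if "n \<ge> 1" for n
  proof -
    note pos = t_pos[OF that]
    have n: "real n > 0" using that by simp
    show "R n > 0" "a n > 0" using pos n by (auto simp: R_def a_def)
    have "t n powr (-1/3) * t n powr 1 = t n powr (2/3)" unfolding powr_add[symmetric] by simp
    then show "R n * t n = a n" using pos by (simp add: R_def a_def mult_ac)
    have "a n * (R n)\<^sup>2 = (t n powr (2/3) * (t n powr (-1/3) * t n powr (-1/3))) *
        (real n powr (1/3) * (real n powr (1/3) * real n powr (1/3)))"
      by (simp add: R_def a_def power2_eq_square)
    also have "\<dots> = real n" unfolding powr_add[symmetric] using pos n by simp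
    finally show "real n = a n * (R n)\<^sup>2" ..
    have "real n powr 1 * real n powr (-2/3) = real n powr (1/3)" unfolding powr_add[symmetric] by simp
    then show "a n = real n * (t n powr (2/3) * real n powr (-2/3))"
      using n by (simp add: a_def mult_ac)
  qed
  obtain c where c: "c > 0" "\<forall>\<^sub>F n in sequentially. c * R n \<le> lam n"
  proof -
    obtain c where c: "c > 0" "\<forall>\<^sub>F n in sequentially. c * norm (R n) \<le> norm (lam n)"
      using lambda_rate unfolding R_def[symmetric] bigtheta_def by (auto elim: landau_omega.bigE)
    have "\<forall>\<^sub>F n in sequentially. c * R n \<le> lam n"
      using c(2) eventually_ge_at_top[of 1]
    proof eventually_elim
      case (elim n)
      then show ?case using R(1)[of n] lambda_nonneg[of n] by simp
    qed
    with c(1) show thesis using that by blast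
  qed
  obtain C where C: "C > 0" "\<forall>\<^sub>F n in sequentially. lam n \<le> C * R n"
  proof -
    obtain C where C: "C > 0" "\<forall>\<^sub>F n in sequentially. norm (lam n) \<le> C * norm (R n)"
      using lambda_rate unfolding R_def[symmetric] bigtheta_def by (auto elim: landau_o.bigE)
    have "\<forall>\<^sub>F n in sequentially. lam n \<le> C * R n"
      using C(2) eventually_ge_at_top[of 1]
    proof eventually_elim
      case (elim n)
      then show ?case using R(1)[of n] lambda_nonneg[of n] by simp
    qed
    with C(1) show thesis using that by blast
  qed
  \<comment> \<open>The additive 1 in the expected excess is absorbed here, by raising
    \<open>t_lower\<close> to the power 2/3.\<close>
  obtain D where D: "D > 0" "\<forall>\<^sub>F n in sequentially. 1 \<le> D * a n"
  proof -
    obtain D where D: "D > 0" "\<forall>\<^sub>F n in sequentially. norm (1 / t n) \<le> D * norm (sqrt (real n))"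
      using t_lower by (auto elim: landau_o.bigE)
    have "\<forall>\<^sub>F n in sequentially. 1 \<le> D powr (2/3) * a n"
      using D(2) eventually_ge_at_top[of 1]
    proof eventually_elim
      case (elim n)
      have pos: "t n > 0" "real n > 0" using elim t_pos by auto
      have "1 \<le> D * sqrt (real n) * t n" using elim pos by (simp add: field_simps)
      then have "1 powr (2/3) \<le> (D * sqrt (real n) * t n) powr (2/3)" by (intro powr_mono2) auto
      also have "\<dots> = D powr (2/3) * (sqrt (real n) powr (2/3) * t n powr (2/3))"
        using D pos by (simp add: powr_mult)
      also have "sqrt (real n) powr (2/3) = real n powr (1/3)"
        using pos by (simp add: powr_half_sqrt[symmetric] powr_powr)
      finally show ?case by (simp add: a_def mult_ac)
    qed
    then show thesis using that[of "D powr (2/3)"] D by simp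
  qed
  \<comment> \<open>Chosen so that Markov's inequality at level \<open>M * a n / \<delta>\<close>
    returns \<delta>: \<open>D\<close> covers the additive 1 and 6912 = 6 * 1152 covers
    \<open>6 * real n / L\<close>.\<close>
  define M where "M = (1 + eighth_moment_bound K \<sigma>) * (D + 6912 / c\<^sup>2)"
  have M: "M > 0" unfolding M_def eighth_moment_bound_def using c D
    by (intro mult_pos_pos add_pos_nonneg add_nonneg_pos) auto
  define A where "A n \<omega> = sq_norm_n n
      (\<lambda>i. fused_lasso n (E n) (ep n) (em n) (lam n) (\<lambda>j. y n j \<omega>) i - \<theta>\<^sub>0 n i)" for n \<omega>
  have meas: "A n \<in> borel_measurable (P n)" if n: "n \<ge> 1" for n
  proof -
    interpret fused_lasso_problem n "E n" "ep n" "em n" "lam n" by (rule problem[OF n])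
    have "y n j \<in> borel_measurable (P n)" if "j \<in> {1..n}" for j
    proof -
      have "\<epsilon> n j \<in> borel_measurable (P n)" using subgauss[OF n that] unfolding sub_Gaussian_def by auto
      then have "(\<lambda>\<omega>. \<theta>\<^sub>0 n j + \<epsilon> n j \<omega>) \<in> borel_measurable (P n)" by measurable
      then show ?thesis using model[OF n that] by (simp cong: measurable_cong)
    qed
    then have "(\<lambda>\<omega>. estimator (\<lambda>j. y n j \<omega>) i) \<in> borel_measurable (P n)" if "i \<in> {1..n}" for i
      using measurable_estimator[OF that] by blast
    then show ?thesis unfolding A_def sq_norm_n_def sq_norm2_def
      by (intro borel_measurable_divide borel_measurable_sum borel_measurable_power
          borel_measurable_diff borel_measurable_const) auto
  qed
  have tail: "\<exists>C'>0. \<forall>\<^sub>F n in sequentially. measure (P n)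
      {\<omega> \<in> space (P n). \<bar>A n \<omega>\<bar> > C' * \<bar>t n powr (2/3) * real n powr (-2/3)\<bar>} \<le> \<delta>"
    if \<delta>: "\<delta> > 0" for \<delta> :: real
  proof (intro exI conjI)
    show "8 * (M / \<delta>) + 8 * C > 0" using M \<delta> C by (simp add: add_pos_pos)
    show "\<forall>\<^sub>F n in sequentially. measure (P n) {\<omega> \<in> space (P n).
        \<bar>A n \<omega>\<bar> > (8 * (M / \<delta>) + 8 * C) * \<bar>t n powr (2/3) * real n powr (-2/3)\<bar>} \<le> \<delta>"
      using c(2) C(2) D(2) eventually_ge_at_top[of 1]
    proof eventually_elim
      case (elim n)
      then have n: "n \<ge> 1" by simp
      interpret fused_lasso_problem n "E n" "ep n" "em n" "lam n" by (rule problem[OF n])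
      interpret sub_Gaussian_family "P n" "\<epsilon> n" "{1..n}" K \<sigma> by (rule fam[OF n])
      note R = R[OF n]
      define b where "b = t n powr (2/3) * real n powr (-2/3)"
      have an: "a n = real n * b" using R(5) by (simp add: b_def)
      have b: "b \<ge> 0" by (simp add: b_def)
      \<comment> \<open>Solves 24 sqrt(2 L) = c R; hence n / L = 1152 a / c^2 with 1152 = 2 *
        24^2.\<close>
      define L where "L = (c * R n / 24)\<^sup>2 / 2"
      have L: "L > 0" using c(1) R(1) by (simp add: L_def)
      have "sqrt (2 * L) = c * R n / 24" unfolding L_def using c(1) R(1) by (simp add: real_sqrt_abs)
      then have L': "24 * sqrt (2 * L) \<le> lam n" using elim(1) by simp
      have "real n / L = 1152 / c\<^sup>2 * a n"
        using c(1) R(1) by (subst R(4)) (simp add: L_def field_simps power2_eq_square)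
      then have nL: "1 + 6 * real n / L \<le> (D + 6912 / c\<^sup>2) * a n"
        using elim(3) unfolding distrib_right times_divide_eq_right[symmetric] by simp
      have u: "M * a n / \<delta> > 0" using M R(2) \<delta> by simp
      have "nabla_norm1 (E n) (ep n) (em n) (\<theta>\<^sub>0 n) \<le> t n" using theta0[OF n] by (simp add: BV_def)
      from estimation_error_tail[OF graph[OF n] n fam[OF n] L L' this model[OF n] u]
      have "measure (P n) {\<omega> \<in> space (P n).
          sq_norm2 n (\<lambda>i. estimator (\<lambda>j. y n j \<omega>) i - \<theta>\<^sub>0 n i) > 8 * (M * a n / \<delta>) + 8 * (lam n * t n)}
        \<le> (1 + eighth_moment_bound K \<sigma>) * (1 + 6 * real n / L) / (M * a n / \<delta>)" .
      also have "\<dots> \<le> (1 + eighth_moment_bound K \<sigma>) * ((D + 6912 / c\<^sup>2) * a n) / (M * a n / \<delta>)"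
        using u nL eighth_moment_bound_nonneg by (intro divide_right_mono mult_left_mono) auto
      also have "\<dots> = M * a n / (M * a n / \<delta>)" by (simp add: M_def mult_ac)
      also have "\<dots> = \<delta>" using M R(2) \<delta> by simp
      finally have bound: "measure (P n) {\<omega> \<in> space (P n).
          sq_norm2 n (\<lambda>i. estimator (\<lambda>j. y n j \<omega>) i - \<theta>\<^sub>0 n i) > 8 * (M * a n / \<delta>) + 8 * (lam n * t n)} \<le> \<delta>" .
      have [measurable]: "A n \<in> borel_measurable (P n)" by (rule meas[OF n])
      have "lam n * t n \<le> C * R n * t n"
        using elim(2) t_pos[OF n] by (intro mult_right_mono) auto
      then have lt: "lam n * t n \<le> C * a n" by (simp add: R(3) mult.assoc)
      have eq: "sq_norm2 n (\<lambda>i. estimator (\<lambda>j. y n j \<omega>) i - \<theta>\<^sub>0 n i) = real n * A n \<omega>" for \<omega>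
        using n by (simp add: A_def sq_norm_n_def)
      have A0: "A n \<omega> \<ge> 0" for \<omega> by (simp add: A_def sq_norm_n_def)
      have "measure (P n) {\<omega> \<in> space (P n). \<bar>A n \<omega>\<bar> > (8 * (M / \<delta>) + 8 * C) * \<bar>b\<bar>} \<le>
          measure (P n) {\<omega> \<in> space (P n). real n * A n \<omega> > 8 * (M * a n / \<delta>) + 8 * (lam n * t n)}"
      proof (rule finite_measure_mono)
        show "{\<omega> \<in> space (P n). \<bar>A n \<omega>\<bar> > (8 * (M / \<delta>) + 8 * C) * \<bar>b\<bar>} \<subseteq>
            {\<omega> \<in> space (P n). real n * A n \<omega> > 8 * (M * a n / \<delta>) + 8 * (lam n * t n)}"
        proof safe
          fix \<omega> assume "(8 * (M / \<delta>) + 8 * C) * \<bar>b\<bar> < \<bar>A n \<omega>\<bar>"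
          then have "real n * ((8 * (M / \<delta>) + 8 * C) * b) < real n * A n \<omega>"
            using b A0 n by (intro mult_strict_left_mono) auto
          moreover have "real n * ((8 * (M / \<delta>) + 8 * C) * b) = 8 * (M * a n / \<delta>) + 8 * (C * a n)"
            by (simp add: an algebra_simps)
          ultimately show "8 * (M * a n / \<delta>) + 8 * (lam n * t n) < real n * A n \<omega>"
            using lt by linarith
        qed
      qed measurable
      also have "\<dots> \<le> \<delta>" using bound unfolding eq .
      finally show ?case unfolding b_def .
    qed
  qed
  show ?thesis
    unfolding bigo_prob_def A_def[symmetric]
  proof (rule conjI)
    show "\<forall>\<^sub>F n in sequentially. A n \<in> borel_measurable (P n)"
      by (rule eventually_mono[OF eventually_ge_at_top[of 1]]) (rule meas)
  qed (rule allI, rule impI, rule tail)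
qed

end
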